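(* Let $\kappa>0$, $R>0$, and let $\boldsymbol J\in H(\mathrm{div};\mathrm{grad};B_R)$ be a source with compact support contained in $B_R$. Then $\boldsymbol J$ is nonradiating if and only if its far-field pattern satisfies $\boldsymbol E_\infty(\hat x)=0$ (for all unit vectors $\hat x\in\mathbb R^3$).
   Context: $B_R=\{x\in\mathbb R^3:|x|<R\}$, $\kappa>0$ is the wavenumber, $g(x,y)=\frac{e^{\mathrm i\kappa|x-y|}}{4\pi|x-y|}$, and $\boldsymbol G(x,y)=[\boldsymbol I+\kappa^{-2}\nabla\nabla]g(x,y)$ is the $3\times3$ dyadic Green's tensor of Maxwell's equations ($\nabla\nabla$ is the Hessian). The electric field generated by $\boldsymbol J$ is $\boldsymbol E(x)=\int_{B_R}\boldsymbol G(x,y)\boldsymbol J(y)\,\mathrm dy$, the solution of $\nabla\times(\nabla\times\boldsymbol E)-\kappa^2\boldsymbol E=\boldsymbol J$ satisfying the Silver--Müller radiation condition. A source $\boldsymbol J$ with compact support contained in $B_R$ is called nonradiating if this $\boldsymbol E$ is identically zero outside $B_R$. The far-field pattern $\boldsymbol E_\infty$ of $\boldsymbol E$ is defined by the asymptotic behavior $\boldsymbol E(x)=\frac{e^{\mathrm i\kappa|x|}}{|x|}\big[\boldsymbol E_\infty(\hat x)+O(1/|x|)\big]$ as $|x|\to\infty$, where $\hat x=x/|x|$. $H(\mathrm{div};\mathrm{grad};B_R)=\{\boldsymbol\Psi\in(L^2(B_R))^3:\nabla(\nabla\cdot\boldsymbol\Psi)\in(L^2(B_R))^3\}$. *)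

theory Defs
  imports "HOL-Analysis.Analysis" "HOL-Library.Landau_Symbols"
begin

definition partial :: "3 \<Rightarrow> (real^3 \<Rightarrow> 'b::real_normed_vector) \<Rightarrow> real^3 \<Rightarrow> 'b" where
  "partial i f x = vector_derivative (\<lambda>t. f (x + t *\<^sub>R axis i 1)) (at 0)"

text \<open>If every iterated partial derivative is differentiable everywhere, then all of
  them are continuous, so this is the usual class of infinitely differentiable functions.\<close>

definition smooth :: "(real^3 \<Rightarrow> 'b::real_normed_vector) \<Rightarrow> bool" where
  "smooth f \<longleftrightarrow> (\<forall>is x. foldr partial is f differentiable (at x))"

definition test_functions :: "(real^3) set \<Rightarrow> (real^3 \<Rightarrow> complex) set" where
  "test_functions S =
     {\<phi>. smooth \<phi> \<and> compact (closure {x. \<phi> x \<noteq> 0}) \<and> closure {x. \<phi> x \<noteq> 0} \<subseteq> S}"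

text \<open>Distributions on \<open>S\<close> are represented as functionals on test functions. Derivatives of
  \<open>L\<^sup>2\<close> fields are taken in this sense.\<close>

definition dist_of :: "(real^3) set \<Rightarrow> (real^3 \<Rightarrow> complex) \<Rightarrow> (real^3 \<Rightarrow> complex) \<Rightarrow> complex" where
  "dist_of S f \<phi> = (LINT x|lebesgue_on S. f x * \<phi> x)"

definition dist_partial ::
  "3 \<Rightarrow> ((real^3 \<Rightarrow> complex) \<Rightarrow> complex) \<Rightarrow> (real^3 \<Rightarrow> complex) \<Rightarrow> complex" where
  "dist_partial i T \<phi> = - T (partial i \<phi>)"

definition dist_div ::
  "(real^3) set \<Rightarrow> (real^3 \<Rightarrow> complex^3) \<Rightarrow> (real^3 \<Rightarrow> complex) \<Rightarrow> complex" where
  "dist_div S \<Psi> \<phi> = (\<Sum>j\<in>UNIV. dist_partial j (dist_of S (\<lambda>x. \<Psi> x $ j)) \<phi>)"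

definition L2_fields :: "(real^3) set \<Rightarrow> (real^3 \<Rightarrow> complex^3) set" where
  "L2_fields S = {\<Psi>. \<Psi> \<in> borel_measurable (lebesgue_on S) \<and>
                      integrable (lebesgue_on S) (\<lambda>x. (norm (\<Psi> x))\<^sup>2)}"

definition H_div_grad :: "(real^3) set \<Rightarrow> (real^3 \<Rightarrow> complex^3) set" where
  "H_div_grad S = {\<Psi> \<in> L2_fields S. \<exists>W \<in> L2_fields S. \<forall>i. \<forall>\<phi> \<in> test_functions S.
     dist_partial i (dist_div S \<Psi>) \<phi> = dist_of S (\<lambda>x. W x $ i) \<phi>}"

text \<open>The support of a function known only up to null sets: the complement of the largest open
  set on which it vanishes almost everywhere.\<close>

definition ess_support :: "(real^3 \<Rightarrow> complex^3) \<Rightarrow> (real^3) set" where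
  "ess_support J = - \<Union>{U. open U \<and> (AE x in lebesgue. x \<in> U \<longrightarrow> J x = 0)}"

definition helmholtz_green :: "real \<Rightarrow> real^3 \<Rightarrow> real^3 \<Rightarrow> complex" where
  "helmholtz_green \<kappa> x y =
     exp (\<i> * of_real (\<kappa> * norm (x - y))) / of_real (4 * pi * norm (x - y))"

text \<open>The Hessian is taken in \<open>x\<close>; taking it in \<open>y\<close> gives the same matrix, because
  \<^const>\<open>helmholtz_green\<close> is an even function of \<open>x - y\<close>.\<close>

definition maxwell_green :: "real \<Rightarrow> real^3 \<Rightarrow> real^3 \<Rightarrow> complex^3^3" where
  "maxwell_green \<kappa> x y = (\<chi> i j. mat 1 $ i $ j * helmholtz_green \<kappa> x y +
     of_real (1 / \<kappa>\<^sup>2) * partial i (partial j (\<lambda>z. helmholtz_green \<kappa> z y)) x)"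

text \<open>The kernel has a non-integrable singularity at \<open>y = x\<close>, so the integral below
  is the electric field only for \<open>x\<close> outside the support of \<open>J\<close>. For sources supported inside the
  ball this covers every point at which the definitions that follow evaluate the field.\<close>

definition electric_field :: "real \<Rightarrow> real \<Rightarrow> (real^3 \<Rightarrow> complex^3) \<Rightarrow> real^3 \<Rightarrow> complex^3" where
  "electric_field \<kappa> R J x = (LINT y|lebesgue_on (ball 0 R). maxwell_green \<kappa> x y *v J y)"

definition nonradiating :: "real \<Rightarrow> real \<Rightarrow> (real^3 \<Rightarrow> complex^3) \<Rightarrow> bool" where
  "nonradiating \<kappa> R J \<longleftrightarrow> (\<forall>x. x \<notin> ball 0 R \<longrightarrow> electric_field \<kappa> R J x = 0)"

definition is_far_field ::
  "real \<Rightarrow> (real^3 \<Rightarrow> complex^3) \<Rightarrow> (real^3 \<Rightarrow> complex^3) \<Rightarrow> bool" where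
  "is_far_field \<kappa> E F \<longleftrightarrow>
     (\<exists>h. (\<lambda>x. norm (h x)) \<in> O[at_infinity](\<lambda>x. 1 / norm x) \<and>
          (\<forall>\<^sub>F x in at_infinity.
             E x = (exp (\<i> * of_real (\<kappa> * norm x)) / of_real (norm x)) *s
                   (F (x /\<^sub>R norm x) + h x)))"

text \<open>The asymptotics determine the pattern on the unit sphere only; its other values are
  irrelevant.\<close>

definition far_field_pattern :: "real \<Rightarrow> (real^3 \<Rightarrow> complex^3) \<Rightarrow> real^3 \<Rightarrow> complex^3" where
  "far_field_pattern \<kappa> E = (SOME F. is_far_field \<kappa> E F)"

lemma is_far_field_unique:
  assumes "is_far_field \<kappa> E F" "is_far_field \<kappa> E F'" "norm u = 1"
  shows "F u = F' u"
proof -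
  obtain h h' where h: "(\<lambda>x. norm (h x)) \<in> O[at_infinity](\<lambda>x. 1 / norm x)"
    and h': "(\<lambda>x. norm (h' x)) \<in> O[at_infinity](\<lambda>x. 1 / norm x)"
    and E: "\<forall>\<^sub>F x in at_infinity. E x = (exp (\<i> * of_real (\<kappa> * norm x)) / of_real (norm x)) *s
                   (F (x /\<^sub>R norm x) + h x)"
    and E': "\<forall>\<^sub>F x in at_infinity. E x = (exp (\<i> * of_real (\<kappa> * norm x)) / of_real (norm x)) *s
                   (F' (x /\<^sub>R norm x) + h' x)"
    using assms(1,2) unfolding is_far_field_def by blast
  have ray: "filterlim (\<lambda>t. t *\<^sub>R u) at_infinity at_top"
    using assms(3) by (intro filterlim_norm_at_top_imp_at_infinity)
      (simp add: filterlim_abs_real)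
  have null: "((\<lambda>x::real^3. 1 / norm x) \<longlongrightarrow> 0) at_infinity"
    by (intro tendsto_divide_0[OF tendsto_const] filterlim_at_top_imp_at_infinity
        filterlim_at_infinity_imp_norm_at_top filterlim_ident)
  have z: "((\<lambda>t. h' (t *\<^sub>R u) - h (t *\<^sub>R u)) \<longlongrightarrow> 0) at_top"
  proof -
    have "(k \<longlongrightarrow> 0) at_infinity" if k: "(\<lambda>x. norm (k x)) \<in> O[at_infinity](\<lambda>x. 1 / norm x)"
      for k :: "real^3 \<Rightarrow> complex^3"
    proof -
      obtain c where "\<forall>\<^sub>F x in at_infinity. norm (norm (k x)) \<le> c * norm (1 / norm x)"
        using landau_o.bigE[OF k] by blast
      then have "\<forall>\<^sub>F x in at_infinity. norm (k x) \<le> c * (1 / norm x)"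
        by (auto elim!: eventually_mono)
      moreover have "((\<lambda>x::real^3. c * (1 / norm x)) \<longlongrightarrow> 0) at_infinity"
        using tendsto_mult_right_zero[OF null] .
      ultimately show ?thesis by (rule Lim_null_comparison)
    qed
    from this[OF h] this[OF h'] have "((\<lambda>x. h' x - h x) \<longlongrightarrow> 0) at_infinity"
      using tendsto_diff by fastforce
    from filterlim_compose[OF this ray] show ?thesis .
  qed
  have "\<forall>\<^sub>F x in at_infinity. F (x /\<^sub>R norm x) - F' (x /\<^sub>R norm x) = h' x - h x"
  proof -
    have "\<forall>\<^sub>F x::real^3 in at_infinity. x \<noteq> 0"
      by (auto simp: eventually_at_infinity intro!: exI[of _ 1])
    with E E' show ?thesis
    proof eventually_elim
      case (elim x)
      then have "F (x /\<^sub>R norm x) + h x = F' (x /\<^sub>R norm x) + h' x"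
        by (metis vector_mul_lcancel divide_eq_0_iff exp_not_eq_zero norm_eq_zero of_real_eq_0_iff)
      then show ?case by (simp add: algebra_simps)
    qed
  qed
  then have "\<forall>\<^sub>F t in at_top. F (t *\<^sub>R u /\<^sub>R norm (t *\<^sub>R u)) - F' (t *\<^sub>R u /\<^sub>R norm (t *\<^sub>R u))
     = h' (t *\<^sub>R u) - h (t *\<^sub>R u)"
    by (rule eventually_compose_filterlim[OF _ ray])
  then have "\<forall>\<^sub>F t in at_top. h' (t *\<^sub>R u) - h (t *\<^sub>R u) = F u - F' u"
    using eventually_gt_at_top[of "0::real"] by eventually_elim (simp add: assms(3))
  with z have "((\<lambda>t::real. F u - F' u) \<longlongrightarrow> 0) at_top"
    by (simp add: tendsto_cong)
  then show ?thesis by (simp add: tendsto_const_iff)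
qed

end

theory Submission
  imports Defs "HOL-Complex_Analysis.Complex_Analysis"
begin

text \<open>
  A nonradiating source has the far field \<open>0\<close>, since the field itself vanishes near infinity and a
  far-field pattern is unique on the unit sphere. The converse is a lemma of Rellich type: a field
  that decays faster than \<open>1/|x|\<close> vanishes outside the ball. Its proof has two parts.

  \<^bold>\<open>From Maxwell to Helmholtz.\<close> For \<open>x\<close> outside the ball the kernel is smooth near the support of \<open>J\<close>.
  Multiplied by a cut-off the Green's function becomes a test function, so the derivatives in the
  dyadic kernel can be moved to the source by the distributional definition of \<open>\<nabla>(\<nabla> \<cdot> J)\<close>.
  Every component of the electric field is therefore a scalar potential \<open>u(x) = \<integral> g(x, y) f(y) dy\<close> of an integrable density with compact
  support in the ball (lemma \<open>electric_field_potential\<close>).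

  \<^bold>\<open>Rellich's lemma by the expansion of Atkinson and Wilcox.\<close> Put \<open>x = r\<theta>\<close> with \<open>|\<theta>| = 1\<close> and \<open>s = 1/r\<close>.
  For fixed \<open>y\<close>, the function \<open>r exp(-i\<kappa>r) g(r\<theta>, y)\<close> depends on \<open>\<theta>\<close> only through \<open>a = \<theta> \<bullet> y\<close>, and it
  is holomorphic in \<open>s\<close> for \<open>|s| < 1/|y|\<close>. Integration of its Taylor series against \<open>f\<close> gives
  \<open>u(r\<theta>) = exp(i\<kappa>r)/r * (c\<^sub>0(\<theta>) + c\<^sub>1(\<theta>)/r + c\<^sub>2(\<theta>)/r\<^sup>2 + ...)\<close>, convergent for all \<open>r\<close> beyond
  the support of \<open>f\<close> (lemma \<open>far_field_expansion\<close>). In particular \<open>c\<^sub>0\<close> is the far-field pattern. The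
  Helmholtz equation turns into the recursion
  \<open>2i\<kappa>(n + 1) c\<^sub>n\<^sub>+\<^sub>1 = n(n + 1) c\<^sub>n + \<Delta> c\<^sub>n\<close> with the Laplace--Beltrami operator \<open>\<Delta>\<close> of the sphere, so
  \<open>c\<^sub>0 = 0\<close> forces all \<open>c\<^sub>n = 0\<close> (lemma \<open>far_field_coeffs_vanish\<close>) and hence \<open>u = 0\<close>.

  The recursion is proved for the integrand, where everything is explicit: the kernel satisfies a
  differential equation in \<open>s\<close> and \<open>a\<close> (lemma \<open>wave_equation\<close>), and Taylor coefficients are written
  as means over a circle, so that they can be differentiated in \<open>a\<close> (lemma \<open>far_coeff_recursion\<close>).
  The operator \<open>\<Delta>\<close> itself appears as the sum of the second derivatives along two orthogonal great
  circles, and in this form it visibly annihilates a function that vanishes on the sphere.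
\<close>

section \<open>Smooth functions and cut-offs\<close>

lemma partial_has_derivative:
  assumes "(f has_derivative f') (at x)"
  shows "partial i f x = f' (axis i 1)"
proof -
  have "((\<lambda>t. x + t *\<^sub>R axis i (1::real)) has_derivative (\<lambda>t. t *\<^sub>R axis i 1)) (at 0)"
    by (auto intro!: derivative_eq_intros)
  moreover have "(f has_derivative f') (at (x + 0 *\<^sub>R axis i 1))"
    using assms by simp
  ultimately have "((\<lambda>t. f (x + t *\<^sub>R axis i 1)) has_derivative (\<lambda>t. f' (t *\<^sub>R axis i 1))) (at 0)"
    by (rule has_derivative_compose)
  moreover have "f' (t *\<^sub>R axis i 1) = t *\<^sub>R f' (axis i 1)" for t
    using assms has_derivative_bounded_linear linear_simps(5) by blast
  ultimately show ?thesis
    unfolding partial_def by (intro vector_derivative_at) (simp add: has_vector_derivative_def)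
qed

lemma partial_cong_open:
  assumes "open S" "x \<in> S" "\<And>y. y \<in> S \<Longrightarrow> f y = g y"
  shows "partial i f x = partial i g x"
proof -
  have "filterlim (\<lambda>t. x + t *\<^sub>R axis i (1::real)) (nhds (x + 0 *\<^sub>R axis i 1)) (nhds 0)"
    by (intro tendsto_intros filterlim_ident)
  then have "\<forall>\<^sub>F t in nhds 0. x + t *\<^sub>R axis i 1 \<in> S"
    using eventually_nhds_in_open[OF assms(1,2)] unfolding filterlim_iff by simp blast
  then have ev: "\<forall>\<^sub>F t in nhds 0. f (x + t *\<^sub>R axis i 1) = g (x + t *\<^sub>R axis i 1)"
    by eventually_elim (rule assms(3))
  show ?thesis
    unfolding partial_def using ev by (intro vector_derivative_cong_eq) auto
qed

lemma differentiable_and_partial_add: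
  assumes "f differentiable at x" "g differentiable at x"
  shows "(\<lambda>x. f x + g x) differentiable at x"
    and "partial i (\<lambda>x. f x + g x) x = partial i f x + partial i g x"
proof -
  obtain f' g' where d: "(f has_derivative f') (at x)" "(g has_derivative g') (at x)"
    using assms unfolding differentiable_def by blast
  show "(\<lambda>x. f x + g x) differentiable at x" using assms by simp
  show "partial i (\<lambda>x. f x + g x) x = partial i f x + partial i g x"
    using partial_has_derivative[OF has_derivative_add[OF d]] d[THEN partial_has_derivative] by simp
qed

lemma differentiable_and_partial_mult:
  fixes f g :: "real^3 \<Rightarrow> 'b::real_normed_algebra"
  assumes "f differentiable at x" "g differentiable at x"
  shows "(\<lambda>x. f x * g x) differentiable at x"
    and "partial i (\<lambda>x. f x * g x) x = f x * partial i g x + partial i f x * g x"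
proof -
  obtain f' g' where d: "(f has_derivative f') (at x)" "(g has_derivative g') (at x)"
    using assms unfolding differentiable_def by blast
  show "(\<lambda>x. f x * g x) differentiable at x" using assms by simp
  show "partial i (\<lambda>x. f x * g x) x = f x * partial i g x + partial i f x * g x"
    using partial_has_derivative[OF has_derivative_mult[OF d]] d[THEN partial_has_derivative] by simp
qed

inductive_set generated_algebra :: "(real^3 \<Rightarrow> 'b::real_normed_algebra) set \<Rightarrow> (real^3 \<Rightarrow> 'b) set"
  for G where
  gen: "g \<in> G \<Longrightarrow> g \<in> generated_algebra G"
| add: "f \<in> generated_algebra G \<Longrightarrow> g \<in> generated_algebra G \<Longrightarrow> (\<lambda>x. f x + g x) \<in> generated_algebra G"
| mult: "f \<in> generated_algebra G \<Longrightarrow> g \<in> generated_algebra G \<Longrightarrow> (\<lambda>x. f x * g x) \<in> generated_algebra G"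

text \<open>Smoothness speaks of all iterated partial derivatives, so it cannot be established
  one derivative at a time. It suffices, though, that first derivatives of generators can be
  written in terms of generators: by the sum and product rules the algebra is then closed under
  differentiation.\<close>

lemma smooth_generated_algebra:
  assumes diff: "\<And>g x. g \<in> G \<Longrightarrow> g differentiable at x"
    and closed: "\<And>g i. g \<in> G \<Longrightarrow> partial i g \<in> generated_algebra G"
    and "f \<in> generated_algebra G"
  shows "smooth f"
proof -
  have step: "(\<forall>x. f differentiable at x) \<and> (\<forall>i. partial i f \<in> generated_algebra G)"
    if "f \<in> generated_algebra G" for f
    using that
  proof induction
    case (gen g)
    then show ?case using diff closed by blast
  next
    case (add f g)
    then have "partial i (\<lambda>x. f x + g x) = (\<lambda>x. partial i f x + partial i g x)" for i
      by (intro ext differentiable_and_partial_add) auto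
    with add show ?case by (auto intro: generated_algebra.add)
  next
    case (mult f g)
    then have "partial i (\<lambda>x. f x * g x) = (\<lambda>x. f x * partial i g x + partial i f x * g x)" for i
      by (intro ext differentiable_and_partial_mult) auto
    moreover have "(\<lambda>x. f x * partial i g x + partial i f x * g x) \<in> generated_algebra G" for i
      using mult by (intro generated_algebra.add generated_algebra.mult) auto
    ultimately show ?case
      using mult by (auto intro: differentiable_and_partial_mult(1))
  qed
  have "foldr partial is f \<in> generated_algebra G" for "is"
    by (induction "is") (use assms(3) step in auto)
  with step show ?thesis unfolding smooth_def by blast
qed

lemma smooth_partial:
  assumes "smooth f"
  shows "smooth (partial i f)"
proof -
  have "foldr partial is (partial i f) = foldr partial (is @ [i]) f" for "is"
    by simp
  then show ?thesis using assms unfolding smooth_def by presburger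
qed

lemma smooth_differentiable:
  assumes "smooth f"
  shows "f differentiable at x"
proof -
  have "foldr partial [] f differentiable at x"
    using assms unfolding smooth_def by blast
  then show ?thesis by simp
qed

lemma smooth_continuous_on: "smooth f \<Longrightarrow> continuous_on S f"
  by (meson differentiable_at_withinI differentiable_imp_continuous_on differentiable_on_def
      smooth_differentiable)

lemma smooth_add_mult:
  fixes f g :: "real^3 \<Rightarrow> 'b::real_normed_algebra"
  assumes "smooth f" "smooth g"
  shows "smooth (\<lambda>x. f x + g x)" and "smooth (\<lambda>x. f x * g x)"
proof -
  define G where "G = range (\<lambda>is. foldr partial is f) \<union> range (\<lambda>is. foldr partial is g)"
  have closed: "partial i h \<in> generated_algebra G" if "h \<in> G" for h i
  proof -
    from that obtain "is" where "h = foldr partial is f \<or> h = foldr partial is g"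
      unfolding G_def by blast
    then have "partial i h = foldr partial (i # is) f \<or> partial i h = foldr partial (i # is) g"
      unfolding foldr.simps comp_apply by metis
    then have "partial i h \<in> G" unfolding G_def by blast
    then show ?thesis by (rule generated_algebra.gen)
  qed
  have diff: "h differentiable at x" if "h \<in> G" for h x
    using that assms unfolding G_def smooth_def by blast
  have "foldr partial [] f \<in> G" "foldr partial [] g \<in> G"
    unfolding G_def by blast+
  then have G: "f \<in> G" "g \<in> G" by simp_all
  show "smooth (\<lambda>x. f x + g x)"
    by (rule smooth_generated_algebra[of G])
      (simp_all add: diff closed generated_algebra.add generated_algebra.gen G)
  show "smooth (\<lambda>x. f x * g x)"
    by (rule smooth_generated_algebra[of G])
      (simp_all add: diff closed generated_algebra.mult generated_algebra.gen G)
qed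

lemmas smooth_add = smooth_add_mult(1) and smooth_mult = smooth_add_mult(2)

lemma partial_const: "partial i (\<lambda>x. c) = (\<lambda>x. 0)"
  by (rule ext, subst partial_has_derivative[where f' = "\<lambda>_. 0"]) auto

lemma smooth_const: "smooth (\<lambda>x. c :: 'b::real_normed_algebra)"
  by (rule smooth_generated_algebra[of "range (\<lambda>c x. c)"])
    (auto simp: partial_const intro!: generated_algebra.gen)

lemma smooth_coordinate: "smooth (\<lambda>x. x $ k)"
proof -
  have d: "((\<lambda>x. x $ k) has_derivative (\<lambda>x. x $ k)) (at x)" for x :: "real^3"
    by (rule bounded_linear_imp_has_derivative[OF bounded_linear_vec_nth])
  have p: "partial i (\<lambda>x. x $ k) = (\<lambda>x. axis i 1 $ k)" for i
    using partial_has_derivative[OF d] by blast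
  have diff: "(\<lambda>x::real^3. x $ k) differentiable at x" for x
    using d differentiable_def by blast
  show ?thesis
    by (rule smooth_generated_algebra[of "insert (\<lambda>x. x $ k) (range (\<lambda>c x. c))"])
      (auto simp: partial_const p diff intro!: generated_algebra.gen)
qed

lemma smooth_norm_diff_square: "smooth (\<lambda>y::real^3. (norm (y - p))\<^sup>2)"
proof -
  have "(\<lambda>y. (norm (y - p))\<^sup>2) = (\<lambda>y. (y $ 1 + - p $ 1) * (y $ 1 + - p $ 1)
      + (y $ 2 + - p $ 2) * (y $ 2 + - p $ 2) + (y $ 3 + - p $ 3) * (y $ 3 + - p $ 3))"
    by (auto simp: power2_norm_eq_inner inner_vec_def sum_3)
  then show ?thesis
    by (simp del: add_uminus_conv_diff)
      (intro smooth_add smooth_mult smooth_coordinate smooth_const)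
qed

lemma of_real_has_vector_derivative: "(of_real has_vector_derivative 1) (at t)"
  using bounded_linear_imp_has_derivative[OF bounded_linear_of_real]
  by (simp add: has_vector_derivative_def of_real_def[abs_def])

lemma partial_compose:
  fixes F :: "real \<Rightarrow> 'b::real_normed_algebra_1"
  assumes "(F has_vector_derivative F') (at (h x))" "h differentiable at x"
  shows "(\<lambda>x. F (h x)) differentiable at x"
    and "partial i (\<lambda>x. F (h x)) x = F' * of_real (partial i h x)"
proof -
  obtain h' where h': "(h has_derivative h') (at x)"
    using assms(2) unfolding differentiable_def by blast
  have "((\<lambda>x. F (h x)) has_derivative (\<lambda>u. h' u *\<^sub>R F')) (at x)"
    using has_derivative_compose[OF h'] assms(1) unfolding has_vector_derivative_def by blast
  then show "(\<lambda>x. F (h x)) differentiable at x"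
    unfolding differentiable_def by blast
  have "partial i (\<lambda>x. F (h x)) x = h' (axis i 1) *\<^sub>R F'"
    by (rule partial_has_derivative) fact
  then show "partial i (\<lambda>x. F (h x)) x = F' * of_real (partial i h x)"
    by (simp add: partial_has_derivative[OF h'] of_real_def)
qed

text \<open>The outer function comes with the sequence \<open>F\<close> of its derivatives, at the values of the
  inner function only, because the profile of the Green's function is singular at \<open>0\<close>. The functions
  \<open>F n \<circ> h\<close> and the iterated partial derivatives of \<open>h\<close> generate an algebra that is closed under
  differentiation.\<close>

lemma smooth_compose:
  fixes F :: "nat \<Rightarrow> real \<Rightarrow> 'b::real_normed_algebra_1"
  assumes F: "\<And>n x. (F n has_vector_derivative F (Suc n) (h x)) (at (h x))" and h: "smooth h"
  shows "smooth (\<lambda>x. F 0 (h x))"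
proof -
  define G where "G = range (\<lambda>n x. F n (h x)) \<union> range (\<lambda>is x. of_real (foldr partial is h x))"
  have dh: "foldr partial is h differentiable at x" for "is" x
    using h unfolding smooth_def by blast
  have of_real: "(\<lambda>x. of_real (foldr partial is h x) :: 'b) differentiable at x"
    "partial i (\<lambda>x. of_real (foldr partial is h x) :: 'b) = (\<lambda>x. of_real (foldr partial (i # is) h x))"
    for "is" i x
  proof -
    have d: "(of_real has_vector_derivative (1::'b)) (at t)" for t
      by (rule of_real_has_vector_derivative)
    show "(\<lambda>x. of_real (foldr partial is h x) :: 'b) differentiable at x"
      by (rule partial_compose(1)[OF d dh])
    show "partial i (\<lambda>x. of_real (foldr partial is h x) :: 'b)
        = (\<lambda>x. of_real (foldr partial (i # is) h x))"
      by (rule ext) (simp add: partial_compose(2)[OF d dh])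
  qed
  have comp: "(\<lambda>x. F n (h x)) differentiable at x"
    "partial i (\<lambda>x. F n (h x)) = (\<lambda>x. F (Suc n) (h x) * of_real (foldr partial [i] h x))" for n i x
    using partial_compose[OF F dh[of "[]", simplified]] by auto
  have G: "(\<lambda>x. F n (h x)) \<in> G" "(\<lambda>x. of_real (foldr partial is h x)) \<in> G" for n "is"
    unfolding G_def by blast+
  show ?thesis
  proof (rule smooth_generated_algebra)
    show "g differentiable at x" if "g \<in> G" for g x
      using that of_real(1) comp(1) unfolding G_def by blast
    show "partial i g \<in> generated_algebra G" if "g \<in> G" for g i
    proof -
      from that consider n where "g = (\<lambda>x. F n (h x))"
        | "is" where "g = (\<lambda>x. of_real (foldr partial is h x))"
        unfolding G_def by blast
      then show ?thesis
      proof cases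
        case 1
        show ?thesis unfolding 1 comp
          by (intro generated_algebra.mult generated_algebra.gen G)
      next
        case 2
        show ?thesis unfolding 2 of_real by (intro generated_algebra.gen G)
      qed
    qed
    show "(\<lambda>x. F 0 (h x)) \<in> generated_algebra G" by (intro generated_algebra.gen G)
  qed
qed

definition flat_exp :: "real poly \<Rightarrow> real \<Rightarrow> real" where
  "flat_exp p t = (if t \<le> 0 then 0 else poly p (1 / t) * exp (- (1 / t)))"

text \<open>Differentiation sends \<open>p\<close> to \<open>X\<^sup>2(p - p')\<close>. Allowing all polynomials thus gives the
  derivatives of \<open>exp(-1/t)\<close> of every order at once; at \<open>0\<close> the exponential beats each \<open>p(1/t)/t\<close>.\<close>

lemma flat_exp_has_derivative:
  "(flat_exp p has_real_derivative flat_exp ([:0, 0, 1:] * (p - pderiv p)) t) (at t)"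
proof -
  consider "t < 0" | "t > 0" | "t = 0" by linarith
  then show ?thesis
  proof cases
    case 1
    have "((\<lambda>_. 0) has_real_derivative 0) (at t)" by simp
    then have "(flat_exp p has_real_derivative 0) (at t)"
      by (rule has_field_derivative_transform_within_open[of _ _ _ "{..<0}"])
        (use 1 in \<open>auto simp: flat_exp_def\<close>)
    with 1 show ?thesis by (simp add: flat_exp_def)
  next
    case 2
    have "((\<lambda>t. poly p (1 / t) * exp (- (1 / t))) has_real_derivative
        flat_exp ([:0, 0, 1:] * (p - pderiv p)) t) (at t)"
      using 2 by (auto intro!: derivative_eq_intros DERIV_chain2[OF poly_DERIV]
          simp: flat_exp_def field_simps power2_eq_square)
    then show ?thesis
      by (rule has_field_derivative_transform_within_open[of _ _ _ "{0<..}"])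
        (use 2 in \<open>auto simp: flat_exp_def\<close>)
  next
    case 3
    have poly_exp: "((\<lambda>u. poly q u / exp u) \<longlongrightarrow> 0) at_top" for q :: "real poly"
    proof -
      have "((\<lambda>u. \<Sum>i\<le>degree q. coeff q i * (u ^ i / exp u)) \<longlongrightarrow> (\<Sum>i\<le>degree q. coeff q i * 0)) at_top"
        by (intro tendsto_intros tendsto_power_div_exp_0)
      then show ?thesis by (simp add: poly_altdef sum_divide_distrib)
    qed
    have "((\<lambda>t. poly (pCons 0 p) (inverse t) / exp (inverse t)) \<longlongrightarrow> 0) (at_right 0)"
      by (rule filterlim_compose[OF poly_exp filterlim_inverse_at_top_right])
    then have "((\<lambda>t. flat_exp p t / t) \<longlongrightarrow> 0) (at_right 0)"
      by (rule Lim_transform_eventually)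
        (auto simp: eventually_at_right_less flat_exp_def field_simps exp_minus
          intro: eventually_at_right_less[THEN eventually_mono])
    moreover have "((\<lambda>t. flat_exp p t / t) \<longlongrightarrow> 0) (at_left 0)"
      by (rule Lim_transform_eventually[of "\<lambda>_. 0"])
        (auto simp: eventually_at_filter flat_exp_def)
    ultimately have "((\<lambda>t. flat_exp p t / t) \<longlongrightarrow> 0) (at 0)"
      by (simp add: filterlim_split_at)
    with 3 show ?thesis
      by (simp add: has_field_derivative_iff flat_exp_def)
  qed
qed

lemma smooth_flat_exp:
  assumes "smooth h"
  shows "smooth (\<lambda>x. flat_exp p (h x))"
proof -
  define D :: "real poly \<Rightarrow> real poly" where "D q = [:0, 0, 1:] * (q - pderiv q)" for q
  have D: "(flat_exp q has_real_derivative flat_exp (D q) t) (at t)" for q t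
    unfolding D_def by (rule flat_exp_has_derivative)
  define F where "F n = flat_exp ((D ^^ n) p)" for n
  have F: "(F n has_vector_derivative F (Suc n) t) (at t)" for n t
    using D[of "(D ^^ n) p" t]
    unfolding F_def funpow.simps comp_apply has_real_derivative_iff_has_vector_derivative .
  have "smooth (\<lambda>x. F 0 (h x))"
    using F assms by (rule smooth_compose)
  then show ?thesis unfolding F_def funpow.simps id_apply .
qed

lemma smooth_of_real:
  assumes "smooth h"
  shows "smooth (\<lambda>x. of_real (h x) :: 'b::real_normed_algebra_1)"
proof -
  define F :: "nat \<Rightarrow> real \<Rightarrow> 'b"
    where "F = (\<lambda>n. case n of 0 \<Rightarrow> of_real | Suc m \<Rightarrow> (\<lambda>_. if m = 0 then 1 else 0))"
  have F: "(F n has_vector_derivative F (Suc n) t) (at t)" for n t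
    by (cases n) (auto simp: F_def of_real_has_vector_derivative)
  have "smooth (\<lambda>x. F 0 (h x))"
    using F assms by (rule smooth_compose)
  then show ?thesis by (simp add: F_def)
qed

text \<open>With \<open>e(t) = exp(-1/t)\<close> for \<open>t > 0\<close> and \<open>e(t) = 0\<close> otherwise, the function
  \<open>e(c - e(t - a\<^sup>2)) / e(c)\<close> is \<open>1\<close> for \<open>t \<le> a\<^sup>2\<close>, and it is \<open>0\<close> for \<open>t \<ge> b\<^sup>2\<close>
  if \<open>c = e(b\<^sup>2 - a\<^sup>2)\<close>.\<close>

lemma smooth_cutoff:
  assumes "0 \<le> a" "a < b"
  obtains \<eta> :: "real^3 \<Rightarrow> real"
  where "smooth \<eta>" "\<And>y. norm y \<le> a \<Longrightarrow> \<eta> y = 1" "\<And>y. b \<le> norm y \<Longrightarrow> \<eta> y = 0"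
proof -
  define c where "c = flat_exp 1 (b\<^sup>2 - a\<^sup>2)"
  have lt: "a\<^sup>2 < b\<^sup>2" using assms by (simp add: power_strict_mono)
  then have c: "c > 0" by (simp add: c_def flat_exp_def)
  define \<eta> :: "real^3 \<Rightarrow> real" where
    "\<eta> y = flat_exp 1 (c + (-1) * flat_exp 1 ((norm (y - 0))\<^sup>2 + - (a\<^sup>2))) * (1 / flat_exp 1 c)" for y
  have smooth: "smooth \<eta>"
    unfolding \<eta>_def
    by (intro smooth_mult smooth_flat_exp smooth_add smooth_const smooth_norm_diff_square)
  have one: "\<eta> y = 1" if "norm y \<le> a" for y
  proof -
    have "(norm y)\<^sup>2 \<le> a\<^sup>2" using that by (simp add: power_mono)
    then show ?thesis using c by (simp add: \<eta>_def flat_exp_def)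
  qed
  have zero: "\<eta> y = 0" if "b \<le> norm y" for y
  proof -
    have y: "b\<^sup>2 \<le> (norm y)\<^sup>2" using that assms by (intro power_mono) auto
    then have "1 / ((norm y)\<^sup>2 - a\<^sup>2) \<le> 1 / (b\<^sup>2 - a\<^sup>2)"
      using lt by (intro divide_left_mono mult_pos_pos) auto
    then have "flat_exp 1 ((norm y)\<^sup>2 - a\<^sup>2) \<ge> c"
      using y lt by (auto simp: c_def flat_exp_def)
    then show ?thesis by (simp add: \<eta>_def flat_exp_def)
  qed
  show thesis by (rule that) (fact smooth one zero)+
qed

section \<open>The outgoing wave in the inverse radius\<close>

text \<open>For \<open>a = \<theta> \<bullet> y\<close>, \<open>B = |y|\<^sup>2\<close> and \<open>s = 1/r\<close> this is \<open>|r\<theta> - y|\<^sup>2/r\<^sup>2\<close>. Complex \<open>s\<close>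
  serves to expand in powers of \<open>s\<close>, complex \<open>a\<close> to differentiate the coefficients in \<open>a\<close>.\<close>

definition rel_sq :: "complex \<Rightarrow> real \<Rightarrow> complex \<Rightarrow> complex" where
  "rel_sq a B s = 1 - 2 * a * s + of_real B * s\<^sup>2"

text \<open>With \<open>q = csqrt (rel_sq a B s)\<close> the phase \<open>(Bs - 2a)/(1 + q)\<close> equals \<open>(q - 1)/s\<close>, which is
  \<open>|r\<theta> - y| - r\<close> for \<open>s = 1/r\<close>, but it is also regular at \<open>s = 0\<close>. The case \<open>m = 1\<close> is \<open>4\<pi>r exp(-i\<kappa>r) g(r\<theta>, y)\<close>;
  the other powers of \<open>q\<close> arise by differentiation.\<close>

definition wave :: "real \<Rightarrow> nat \<Rightarrow> complex \<Rightarrow> real \<Rightarrow> complex \<Rightarrow> complex" where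
  "wave \<kappa> m a B s =
     exp (\<i> * \<kappa> * ((B * s - 2 * a) / (1 + csqrt (rel_sq a B s)))) / csqrt (rel_sq a B s) ^ m"

text \<open>Complex square roots are kept atomic: the proofs argue with their squares and the sign of
  their real parts.\<close>

declare csqrt.simps [simp del]

lemma csqrt_right_half_plane:
  assumes "z \<notin> \<real>\<^sub>\<le>\<^sub>0"
  shows "Re (csqrt z) > 0" "csqrt z \<noteq> 0" "1 + csqrt z \<noteq> 0"
proof -
  have "Re (csqrt z) \<noteq> 0"
  proof
    assume "Re (csqrt z) = 0"
    then have "csqrt z = \<i> * Im (csqrt z)"
      unfolding complex_eq_iff by (simp del: csqrt.simps)
    from arg_cong[OF this, of "\<lambda>w. w\<^sup>2"] have "z = (\<i> * Im (csqrt z))\<^sup>2"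
      unfolding power2_csqrt .
    then have "z = of_real (- (Im (csqrt z))\<^sup>2)"
      by (simp add: power_mult_distrib)
    then have "z \<in> \<real>\<^sub>\<le>\<^sub>0" by (metis neg_le_0_iff_le nonpos_Reals_of_real_iff zero_le_power2)
    then show False using assms by blast
  qed
  then show 1: "Re (csqrt z) > 0" using csqrt_principal[of z] by linarith
  then show "csqrt z \<noteq> 0" "1 + csqrt z \<noteq> 0" by (auto simp: complex_eq_iff add_eq_0_iff)
qed

text \<open>For small \<open>s\<close> the quantity stays close to \<open>1\<close>, for complex \<open>a\<close> as well; this leaves room for
  complex differentiation in \<open>a\<close>.\<close>

lemma rel_sq_domain_small:
  assumes "norm a \<le> r" "0 \<le> B" "B \<le> r\<^sup>2" "norm s * r \<le> 1 / 4"
  shows "rel_sq a B s \<notin> \<real>\<^sub>\<le>\<^sub>0"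
proof -
  have "norm (a * s) \<le> 1 / 4"
    using assms(4) mult_right_mono[OF assms(1) norm_ge_zero[of s]]
    by (simp add: norm_mult mult.commute)
  moreover have "B * (norm s)\<^sup>2 \<le> (1 / 4)\<^sup>2"
  proof -
    have "0 \<le> r" using assms(1) norm_ge_zero order_trans by blast
    have "B * (norm s)\<^sup>2 \<le> r\<^sup>2 * (norm s)\<^sup>2" using assms by (simp add: mult_right_mono)
    also have "\<dots> = (norm s * r)\<^sup>2" by (simp add: power_mult_distrib)
    also have "\<dots> \<le> (1 / 4)\<^sup>2" using assms \<open>0 \<le> r\<close> by (intro power_mono) auto
    finally show ?thesis .
  qed
  ultimately have "norm (2 * (a * s) - of_real B * s\<^sup>2) \<le> 2 * (1 / 4) + (1 / 4)\<^sup>2"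
    using assms(2) by (intro norm_triangle_le_diff add_mono) (auto simp: norm_mult norm_power)
  then have "norm (2 * (a * s) - of_real B * s\<^sup>2) < 1" by (simp add: power2_eq_square)
  then have "Re (2 * (a * s) - of_real B * s\<^sup>2) < 1"
    using complex_Re_le_cmod[of "2 * (a * s) - of_real B * s\<^sup>2"] by linarith
  then have "Re (rel_sq a B s) > 0" unfolding rel_sq_def by (simp add: mult.assoc)
  then show ?thesis by (auto simp: complex_nonpos_Reals_iff)
qed

text \<open>For real \<open>a\<close> the full disc \<open>|s| < 1/\<surd>B\<close> is admissible, and this is what makes the expansion
  converge up to the support of the source. The zeros of the real quadratic polynomial
  \<open>1 + c - 2as + Bs\<^sup>2\<close> with \<open>a\<^sup>2 \<le> B\<close> and \<open>c \<ge> 0\<close> are complex conjugate, hence of absolute value at least \<open>1/\<surd>B\<close>.\<close>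

lemma rel_sq_domain:
  fixes a :: real
  assumes "a\<^sup>2 \<le> B" "B * (norm s)\<^sup>2 < 1"
  shows "rel_sq a B s \<notin> \<real>\<^sub>\<le>\<^sub>0"
proof
  assume "rel_sq a B s \<in> \<real>\<^sub>\<le>\<^sub>0"
  then have im: "Im (rel_sq a B s) = 0" and re: "Re (rel_sq a B s) \<le> 0"
    by (auto simp: complex_nonpos_Reals_iff)
  have ns: "(norm s)\<^sup>2 = (Re s)\<^sup>2 + (Im s)\<^sup>2" by (simp add: cmod_power2)
  have Re: "Re (rel_sq a B s) = 1 - 2 * a * Re s + B * ((Re s)\<^sup>2 - (Im s)\<^sup>2)"
    by (simp add: rel_sq_def power2_eq_square)
  have "Im (rel_sq a B s) = 2 * Im s * (B * Re s - a)"
    by (simp add: rel_sq_def power2_eq_square algebra_simps)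
  with im consider "Im s = 0" | "a = B * Re s" by auto
  then show False
  proof cases
    case 1
    have "0 \<le> B" using assms(1) zero_le_power2 order_trans by blast
    have "(a * Re s)\<^sup>2 \<le> B * (Re s)\<^sup>2"
      using mult_right_mono[OF assms(1), of "(Re s)\<^sup>2"] by (simp add: power_mult_distrib)
    also have "\<dots> < 1" using assms(2) ns 1 by simp
    finally have "\<bar>a * Re s\<bar> < 1" by (simp add: abs_square_less_1)
    then have "0 < (1 - a * Re s)\<^sup>2" by auto
    also have "(1 - a * Re s)\<^sup>2 = 1 - 2 * a * Re s + (a * Re s)\<^sup>2"
      by (simp add: power2_eq_square algebra_simps)
    also have "\<dots> \<le> Re (rel_sq a B s)" using Re 1 \<open>(a * Re s)\<^sup>2 \<le> B * (Re s)\<^sup>2\<close> by simp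
    finally show False using re by simp
  next
    case 2
    have "Re (rel_sq a B s) = 1 - B * (norm s)\<^sup>2"
      using Re unfolding ns 2 by (simp add: power2_eq_square algebra_simps)
    then show False using re assms(2) by simp
  qed
qed

lemma continuous_on_wave:
  assumes "continuous_on S a" "continuous_on S B" "continuous_on S s"
    and "\<And>p. p \<in> S \<Longrightarrow> rel_sq (a p) (B p) (s p) \<notin> \<real>\<^sub>\<le>\<^sub>0"
  shows "continuous_on S (\<lambda>p. wave \<kappa> m (a p) (B p) (s p))"
proof -
  have "continuous_on S (\<lambda>p. csqrt (rel_sq (a p) (B p) (s p)))"
    by (rule continuous_on_compose2[OF continuous_on_csqrt])
      (use assms in \<open>auto simp: rel_sq_def intro!: continuous_intros\<close>)
  then show ?thesis
    unfolding wave_def using assms csqrt_right_half_plane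
    by (intro continuous_intros) auto
qed

lemma holomorphic_on_wave:
  assumes "\<And>s. s \<in> S \<Longrightarrow> rel_sq a B s \<notin> \<real>\<^sub>\<le>\<^sub>0"
  shows "wave \<kappa> m a B holomorphic_on S"
proof -
  have "rel_sq a B holomorphic_on S"
    unfolding rel_sq_def[abs_def] by (intro holomorphic_intros)
  moreover from this have "(\<lambda>s. csqrt (rel_sq a B s)) holomorphic_on S"
    using assms by (intro holomorphic_on_csqrt') auto
  ultimately show ?thesis
    unfolding wave_def[abs_def] using assms csqrt_right_half_plane
    by (intro holomorphic_intros) auto
qed

text \<open>Here \<open>q\<close> stands for \<open>csqrt (rel_sq a B s)\<close>; the two identities are the values of
  the \<open>a\<close>- and \<open>s\<close>-derivatives of the phase \<open>(Bs - 2a)/(1 + q) = (q - 1)/s\<close>.\<close>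

lemma phase_derivative_identities:
  fixes q a B s :: complex
  assumes "q \<noteq> 0" "1 + q \<noteq> 0" and q2: "q\<^sup>2 = 1 - 2 * a * s + B * s\<^sup>2"
  shows "(- 2 * (1 + q) - (B * s - 2 * a) * (- s / q)) / (1 + q)\<^sup>2 = - 1 / q"
    and "s \<noteq> 0 \<Longrightarrow> (B * (1 + q) - (B * s - 2 * a) * ((B * s - a) / q)) / (1 + q)\<^sup>2
      = (a * s - 1 + q) / (q * s\<^sup>2)"
proof -
  have Bs: "(B * s - 2 * a) * s = (q - 1) * (1 + q)"
    using q2 by (simp add: power2_eq_square algebra_simps)
  have "- 2 * (1 + q) - (B * s - 2 * a) * (- s / q) = - 2 * (1 + q) + (q - 1) * (1 + q) / q"
    using Bs by simp
  also have "\<dots> = - 1 / q * (1 + q)\<^sup>2"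
    using assms(1) by (simp add: field_simps power2_eq_square)
  finally show "(- 2 * (1 + q) - (B * s - 2 * a) * (- s / q)) / (1 + q)\<^sup>2 = - 1 / q"
    using assms(2) by simp
  assume "s \<noteq> 0"
  have "(B * (1 + q) * q - (B * s - 2 * a) * (B * s - a)) * s\<^sup>2 = (a * s - 1 + q) * (1 + q)\<^sup>2"
    using q2 by algebra
  moreover have "B * (1 + q) - (B * s - 2 * a) * ((B * s - a) / q)
      = (B * (1 + q) * q - (B * s - 2 * a) * (B * s - a)) / q"
    using assms(1) by (simp add: field_simps)
  ultimately show "(B * (1 + q) - (B * s - 2 * a) * ((B * s - a) / q)) / (1 + q)\<^sup>2
      = (a * s - 1 + q) / (q * s\<^sup>2)"
    using assms(1,2) \<open>s \<noteq> 0\<close> by (simp add: frac_eq_eq mult_ac)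
qed

lemma has_field_derivative_divide_power:
  fixes f g :: "complex \<Rightarrow> complex"
  assumes "(f has_field_derivative f') (at x)" "(g has_field_derivative g') (at x)" "g x \<noteq> 0"
  shows "((\<lambda>x. f x / g x ^ m) has_field_derivative
    f' / g x ^ m - of_nat m * f x * g' / g x ^ (m + 1)) (at x)"
proof (cases m)
  case 0
  then show ?thesis using assms(1) by simp
next
  case (Suc k)
  have "((\<lambda>x. f x / g x ^ m) has_field_derivative
      (f' * g x ^ m - f x * (of_nat m * (g' * g x ^ k))) / (g x ^ m * g x ^ m)) (at x)"
    using DERIV_divide[OF assms(1) DERIV_power[OF assms(2), of m]] assms(3) Suc by simp
  also have "(f' * g x ^ m - f x * (of_nat m * (g' * g x ^ k))) / (g x ^ m * g x ^ m)
      = f' / g x ^ m - of_nat m * f x * g' / g x ^ (m + 1)"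
    using assms(3) unfolding Suc by (simp add: field_simps)
  finally show ?thesis .
qed

lemma wave_derivative_angle:
  assumes "rel_sq a B s \<notin> \<real>\<^sub>\<le>\<^sub>0"
  shows "((\<lambda>a. wave \<kappa> m a B s) has_field_derivative
    - \<i> * \<kappa> * wave \<kappa> (m + 1) a B s + m * s * wave \<kappa> (m + 2) a B s) (at a)"
proof -
  define q where "q = csqrt (rel_sq a B s)"
  have q: "q \<noteq> 0" "1 + q \<noteq> 0" "q\<^sup>2 = 1 - 2 * a * s + B * s\<^sup>2"
    using csqrt_right_half_plane[OF assms] by (simp_all add: q_def) (simp add: rel_sq_def)
  have dq: "((\<lambda>a. csqrt (rel_sq a B s)) has_field_derivative - s / q) (at a)"
    unfolding q_def using assms
    by (auto simp: rel_sq_def intro!: derivative_eq_intros)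
  have "((\<lambda>a. B * s - 2 * a) has_field_derivative - 2) (at a)"
    "((\<lambda>a. 1 + csqrt (rel_sq a B s)) has_field_derivative - s / q) (at a)"
    using DERIV_add[OF DERIV_const dq, of 1] by (auto intro!: derivative_eq_intros)
  from DERIV_divide[OF this] q
  have "((\<lambda>a. (B * s - 2 * a) / (1 + csqrt (rel_sq a B s))) has_field_derivative
     (- 2 * (1 + q) - (B * s - 2 * a) * (- s / q)) / (1 + q)\<^sup>2) (at a)"
    unfolding q_def[symmetric] power2_eq_square by blast
  then have dp: "((\<lambda>a. (B * s - 2 * a) / (1 + csqrt (rel_sq a B s))) has_field_derivative - 1 / q) (at a)"
    unfolding phase_derivative_identities(1)[OF q] .
  have de: "((\<lambda>a. exp (\<i> * \<kappa> * ((B * s - 2 * a) / (1 + csqrt (rel_sq a B s)))))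
      has_field_derivative \<i> * \<kappa> * (- 1 / q) * exp (\<i> * \<kappa> * ((B * s - 2 * a) / (1 + q)))) (at a)"
    using DERIV_chain2[of exp, OF DERIV_exp DERIV_cmult[OF dp, of "\<i> * \<kappa>"]] by (simp add: q_def mult_ac)
  show ?thesis
    unfolding wave_def
    using has_field_derivative_divide_power[OF de dq, of m] q(1)
    by (simp add: q_def[symmetric] mult_ac add_ac)
qed

lemma wave_derivative_radius:
  assumes "rel_sq a B s \<notin> \<real>\<^sub>\<le>\<^sub>0" "s \<noteq> 0"
  shows "(wave \<kappa> m a B has_field_derivative
    \<i> * \<kappa> / s\<^sup>2 * ((a * s - 1) * wave \<kappa> (m + 1) a B s + wave \<kappa> m a B s)
      - m * (B * s - a) * wave \<kappa> (m + 2) a B s) (at s)"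
proof -
  define q where "q = csqrt (rel_sq a B s)"
  have q: "q \<noteq> 0" "1 + q \<noteq> 0" "q\<^sup>2 = 1 - 2 * a * s + B * s\<^sup>2"
    using csqrt_right_half_plane[OF assms(1)] by (simp_all add: q_def) (simp add: rel_sq_def)
  have "(rel_sq a B has_field_derivative 2 * (B * s - a)) (at s)"
    unfolding rel_sq_def[abs_def] by (auto intro!: derivative_eq_intros simp: algebra_simps)
  from DERIV_chain2[where f = csqrt, OF has_field_derivative_csqrt[OF assms(1)] this]
  have "((\<lambda>s. csqrt (rel_sq a B s)) has_field_derivative inverse (2 * q) * (2 * (B * s - a))) (at s)"
    unfolding q_def .
  moreover have "inverse (2 * q) * (2 * (B * s - a)) = (B * s - a) / q"
    using q(1) by (simp add: field_simps)
  ultimately have dq: "((\<lambda>s. csqrt (rel_sq a B s)) has_field_derivative (B * s - a) / q) (at s)"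
    by (simp only:)
  have "((\<lambda>s. B * s - 2 * a) has_field_derivative B) (at s)"
    "((\<lambda>s. 1 + csqrt (rel_sq a B s)) has_field_derivative (B * s - a) / q) (at s)"
    using DERIV_add[OF DERIV_const dq, of 1] by (auto intro!: derivative_eq_intros)
  from DERIV_divide[OF this] q
  have "((\<lambda>s. (B * s - 2 * a) / (1 + csqrt (rel_sq a B s))) has_field_derivative
     (B * (1 + q) - (B * s - 2 * a) * ((B * s - a) / q)) / (1 + q)\<^sup>2) (at s)"
    unfolding q_def[symmetric] power2_eq_square by blast
  then have dp: "((\<lambda>s. (B * s - 2 * a) / (1 + csqrt (rel_sq a B s))) has_field_derivative
      (a * s - 1 + q) / (q * s\<^sup>2)) (at s)"
    unfolding phase_derivative_identities(2)[OF q assms(2)] .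
  have de: "((\<lambda>s. exp (\<i> * \<kappa> * ((B * s - 2 * a) / (1 + csqrt (rel_sq a B s)))))
      has_field_derivative \<i> * \<kappa> * ((a * s - 1 + q) / (q * s\<^sup>2))
        * exp (\<i> * \<kappa> * ((B * s - 2 * a) / (1 + q)))) (at s)"
    using DERIV_chain2[of exp, OF DERIV_exp DERIV_cmult[OF dp, of "\<i> * \<kappa>"]] by (simp add: q_def mult_ac)
  have "\<i> * \<kappa> * ((a * s - 1 + q) / (q * s\<^sup>2)) * E / q ^ m - m * E * ((B * s - a) / q) / q ^ (m + 1)
      = \<i> * \<kappa> / s\<^sup>2 * ((a * s - 1) * (E / q ^ (m + 1)) + E / q ^ m) - m * (B * s - a) * (E / q ^ (m + 2))" for E :: complex
    using q(1) assms(2) by (simp add: divide_simps) (simp add: algebra_simps)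
  then show ?thesis
    unfolding wave_def[abs_def]
    using has_field_derivative_divide_power[OF de dq, of m] q(1)
    by (simp add: q_def[symmetric])
qed

text \<open>The first and second derivative of \<open>wave \<kappa> 1\<close> in \<open>a\<close>, and its image under the Euler operator
  \<open>s d/ds\<close>.\<close>

definition wave_a :: "real \<Rightarrow> complex \<Rightarrow> real \<Rightarrow> complex \<Rightarrow> complex" where
  "wave_a \<kappa> a B s = - \<i> * \<kappa> * wave \<kappa> 2 a B s + s * wave \<kappa> 3 a B s"

definition wave_aa :: "real \<Rightarrow> complex \<Rightarrow> real \<Rightarrow> complex \<Rightarrow> complex" where
  "wave_aa \<kappa> a B s =
     - \<kappa>\<^sup>2 * wave \<kappa> 3 a B s - 3 * \<i> * \<kappa> * s * wave \<kappa> 4 a B s + 3 * s\<^sup>2 * wave \<kappa> 5 a B s"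

definition wave_radial :: "real \<Rightarrow> complex \<Rightarrow> real \<Rightarrow> complex \<Rightarrow> complex" where
  "wave_radial \<kappa> a B s =
     \<i> * \<kappa> * ((a * s - 1) / s * wave \<kappa> 2 a B s + wave \<kappa> 1 a B s / s) - s * (B * s - a) * wave \<kappa> 3 a B s"

lemma wave_derivatives:
  assumes "rel_sq a B s \<notin> \<real>\<^sub>\<le>\<^sub>0"
  shows "((\<lambda>a. wave \<kappa> 1 a B s) has_field_derivative wave_a \<kappa> a B s) (at a)"
    and "((\<lambda>a. wave_a \<kappa> a B s) has_field_derivative wave_aa \<kappa> a B s) (at a)"
    and "s \<noteq> 0 \<Longrightarrow> (wave \<kappa> 1 a B has_field_derivative wave_radial \<kappa> a B s / s) (at s)"
proof -
  note d = wave_derivative_angle[OF assms, of \<kappa>]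
  show "((\<lambda>a. wave \<kappa> 1 a B s) has_field_derivative wave_a \<kappa> a B s) (at a)"
    using d[of 1] by (simp add: wave_a_def eval_nat_numeral)
  have "- \<i> * \<kappa> * (- \<i> * \<kappa> * wave \<kappa> (2 + 1) a B s + (2::nat) * s * wave \<kappa> (2 + 2) a B s)
      + s * (- \<i> * \<kappa> * wave \<kappa> (3 + 1) a B s + (3::nat) * s * wave \<kappa> (3 + 2) a B s)
    = wave_aa \<kappa> a B s"
    by (simp add: wave_aa_def eval_nat_numeral algebra_simps)
  moreover have "((\<lambda>a. wave_a \<kappa> a B s) has_field_derivative
      - \<i> * \<kappa> * (- \<i> * \<kappa> * wave \<kappa> (2 + 1) a B s + (2::nat) * s * wave \<kappa> (2 + 2) a B s)
      + s * (- \<i> * \<kappa> * wave \<kappa> (3 + 1) a B s + (3::nat) * s * wave \<kappa> (3 + 2) a B s)) (at a)"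
    unfolding wave_a_def by (intro DERIV_add DERIV_cmult d)
  ultimately show "((\<lambda>a. wave_a \<kappa> a B s) has_field_derivative wave_aa \<kappa> a B s) (at a)"
    by metis
  assume "s \<noteq> 0"
  then have "\<i> * \<kappa> / s\<^sup>2 * ((a * s - 1) * wave \<kappa> (1 + 1) a B s + wave \<kappa> 1 a B s)
      - (1::nat) * (B * s - a) * wave \<kappa> (1 + 2) a B s = wave_radial \<kappa> a B s / s"
    unfolding wave_radial_def
    by (simp add: numeral_2_eq_2[symmetric] numeral_3_eq_3[symmetric] divide_simps)
      (simp add: power2_eq_square algebra_simps)
  then show "(wave \<kappa> 1 a B has_field_derivative wave_radial \<kappa> a B s / s) (at s)"
    using wave_derivative_radius[OF assms \<open>s \<noteq> 0\<close>, of \<kappa> 1] by metis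
qed

lemma wave_lower_index: "rel_sq a B s \<notin> \<real>\<^sub>\<le>\<^sub>0 \<Longrightarrow> wave \<kappa> m a B s = rel_sq a B s * wave \<kappa> (m + 2) a B s"
  using csqrt_right_half_plane(2)[of "rel_sq a B s"]
  by (simp add: wave_def power_add del: add_2_eq_Suc')

text \<open>The Helmholtz equation for \<open>exp(i\<kappa>r)/r * v\<close> with \<open>v = wave \<kappa> 1 a B (1/r)\<close>. In terms of
  \<open>D = s d/ds\<close> it reads \<open>D\<^sup>2v + Dv - 2i\<kappa> Dv/s + (B - a\<^sup>2) v\<^sub>a\<^sub>a - 2a v\<^sub>a = 0\<close>; the last two terms are
  the Laplace--Beltrami operator of the sphere, applied to a function of \<open>a = \<theta> \<bullet> y\<close>.\<close>

lemma wave_equation: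
  assumes "rel_sq a B s \<notin> \<real>\<^sub>\<le>\<^sub>0" "s \<noteq> 0"
  shows "(wave_radial \<kappa> a B has_field_derivative
    (2 * \<i> * \<kappa> * (wave_radial \<kappa> a B s / s) - wave_radial \<kappa> a B s
      - (B - a\<^sup>2) * wave_aa \<kappa> a B s + 2 * a * wave_a \<kappa> a B s) / s) (at s)"
proof -
  define D where "D m = \<i> * \<kappa> / s\<^sup>2 * ((a * s - 1) * wave \<kappa> (m + 1) a B s + wave \<kappa> m a B s)
      - m * (B * s - a) * wave \<kappa> (m + 2) a B s" for m :: nat
  have D: "(wave \<kappa> m a B has_field_derivative D m) (at s)" for m
    unfolding D_def by (rule wave_derivative_radius[OF assms])
  have "((\<lambda>s. (a * s - 1) / s) has_field_derivative 1 / s\<^sup>2) (at s)"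
    using assms(2) by (auto intro!: derivative_eq_intros simp: field_simps power2_eq_square)
  note 1 = DERIV_mult[OF this D[of 2]] and 2 = DERIV_divide[OF D[of 1] DERIV_ident assms(2)]
  have "((\<lambda>s. s * (B * s - a)) has_field_derivative (2 * B * s - a)) (at s)"
    by (auto intro!: derivative_eq_intros simp: algebra_simps)
  note 3 = DERIV_mult[OF this D[of 3]]
  have D': "(wave_radial \<kappa> a B has_field_derivative
     \<i> * \<kappa> * (1 / s\<^sup>2 * wave \<kappa> 2 a B s + D 2 * ((a * s - 1) / s)
       + (D 1 * s - wave \<kappa> 1 a B s * 1) / (s * s))
     - ((2 * B * s - a) * wave \<kappa> 3 a B s + D 3 * (s * (B * s - a)))) (at s)"
    unfolding wave_radial_def[abs_def] by (intro DERIV_diff DERIV_cmult DERIV_add 1 2 3)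
  \<comment> \<open>All terms are expressed by the functions with \<open>m = 4\<close> and \<open>m = 5\<close>, over which
    the equation is an identity of polynomials.\<close>
  define Q where "Q = rel_sq a B s"
  define k where "k = \<i> * complex_of_real \<kappa>"
  define X where "X = wave \<kappa> 5 a B s"
  define Y where "Y = wave \<kappa> 4 a B s"
  have w: "wave \<kappa> 4 a B s = Y" "wave \<kappa> 5 a B s = X" "wave \<kappa> 3 a B s = Q * X"
    "wave \<kappa> 2 a B s = Q * Y" "wave \<kappa> 1 a B s = Q * (Q * X)"
    using wave_lower_index[OF assms(1), of \<kappa>, of 3] wave_lower_index[OF assms(1), of \<kappa>, of 2]
      wave_lower_index[OF assms(1), of \<kappa>, of 1] by (simp_all add: Q_def X_def Y_def eval_nat_numeral)
  have k2: "- (complex_of_real \<kappa>)\<^sup>2 = k\<^sup>2" by (simp add: k_def power_mult_distrib)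
  have "D 1 = k / s\<^sup>2 * ((a * s - 1) * (Q * Y) + Q * (Q * X)) - (B * s - a) * (Q * X)"
    "D 2 = k / s\<^sup>2 * ((a * s - 1) * (Q * X) + Q * Y) - 2 * (B * s - a) * Y"
    "D 3 = k / s\<^sup>2 * ((a * s - 1) * Y + Q * X) - 3 * (B * s - a) * X"
    using w by (simp_all add: D_def k_def eval_nat_numeral)
  note D_eq = this
  have "k * (1 / s\<^sup>2 * (Q * Y) + D 2 * ((a * s - 1) / s) + (D 1 * s - Q * (Q * X) * 1) / (s * s))
     - ((2 * B * s - a) * (Q * X) + D 3 * (s * (B * s - a)))
    = (2 * k * ((k * ((a * s - 1) / s * (Q * Y) + Q * (Q * X) / s) - s * (B * s - a) * (Q * X)) / s)
      - (k * ((a * s - 1) / s * (Q * Y) + Q * (Q * X) / s) - s * (B * s - a) * (Q * X))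
      - (B - a\<^sup>2) * (k\<^sup>2 * (Q * X) - 3 * k * s * Y + 3 * s\<^sup>2 * X)
      + 2 * a * (- k * (Q * Y) + s * (Q * X))) / s"
    unfolding D_eq unfolding Q_def rel_sq_def
    using assms(2) by (simp add: divide_simps) (simp add: eval_nat_numeral algebra_simps)
  with D' show ?thesis
    unfolding wave_radial_def wave_a_def wave_aa_def w k2
    unfolding k_def by (simp add: mult.assoc)
qed

section \<open>Taylor coefficients as means over a circle\<close>

text \<open>For a holomorphic function this is the coefficient of \<open>s\<^sup>n\<close>. Written as an
  integral, it can be differentiated in parameters of the function.\<close>

definition circle_mean :: "real \<Rightarrow> nat \<Rightarrow> (complex \<Rightarrow> complex) \<Rightarrow> complex" where
  "circle_mean \<rho> n F = integral {0..1} (\<lambda>t. F (circlepath 0 \<rho> t) / circlepath 0 \<rho> t ^ n)"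

lemma circlepath_in_sphere: "0 \<le> \<rho> \<Longrightarrow> circlepath 0 \<rho> t \<in> sphere 0 \<rho>"
  by (simp add: circlepath norm_mult norm_exp_eq_Re)

lemma circle_mean_integrable:
  assumes "continuous_on (sphere 0 \<rho>) F" "0 < \<rho>"
  shows "(\<lambda>t. F (circlepath 0 \<rho> t) / circlepath 0 \<rho> t ^ n) integrable_on {0..1}"
proof (rule integrable_continuous_real)
  have "continuous_on {0..1} (\<lambda>t. circlepath 0 \<rho> t)"
    unfolding circlepath by (intro continuous_intros)
  moreover from this have "continuous_on {0..1} (\<lambda>t. F (circlepath 0 \<rho> t))"
    using assms circlepath_in_sphere[of \<rho>] by (intro continuous_on_compose2[OF assms(1)]) auto
  moreover have "circlepath 0 \<rho> t \<noteq> 0" for t using assms(2) by (simp add: circlepath)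
  ultimately show "continuous_on {0..1} (\<lambda>t. F (circlepath 0 \<rho> t) / circlepath 0 \<rho> t ^ n)"
    by (intro continuous_intros) auto
qed

lemma circle_mean_add:
  assumes "continuous_on (sphere 0 \<rho>) F" "continuous_on (sphere 0 \<rho>) G" "0 < \<rho>"
  shows "circle_mean \<rho> n (\<lambda>s. F s + G s) = circle_mean \<rho> n F + circle_mean \<rho> n G"
  unfolding circle_mean_def add_divide_distrib
  by (intro integral_add circle_mean_integrable assms)

lemma circle_mean_cmult: "circle_mean \<rho> n (\<lambda>s. c * F s) = c * circle_mean \<rho> n F"
  unfolding circle_mean_def times_divide_eq_right[symmetric] by (rule integral_mult_right)

lemma circle_mean_shift:
  "circle_mean \<rho> n (\<lambda>s. F s / s) = circle_mean \<rho> (Suc n) F"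
  unfolding circle_mean_def by (simp add: mult.commute)

text \<open>Integration by parts on the circle: the operator \<open>s d/ds\<close> multiplies the
  coefficient of \<open>s\<^sup>n\<close> by \<open>n\<close>.\<close>

lemma circle_mean_Euler:
  assumes "0 < \<rho>" and F: "\<And>s. norm s = \<rho> \<Longrightarrow> (F has_field_derivative G s / s) (at s)"
    and G: "continuous_on (sphere 0 \<rho>) G"
  shows "circle_mean \<rho> n G = of_nat n * circle_mean \<rho> n F"
proof -
  define \<gamma> where "\<gamma> = circlepath 0 \<rho>"
  have \<gamma>: "norm (\<gamma> t) = \<rho>" "\<gamma> t \<noteq> 0" for t
    using circlepath_in_sphere[of \<rho> t] assms(1) by (auto simp: \<gamma>_def)
  have d\<gamma>: "(\<gamma> has_vector_derivative 2 * pi * \<i> * \<gamma> t) (at t within X)" for t X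
    using has_vector_derivative_circlepath[of 0 \<rho> t X] by (simp add: \<gamma>_def circlepath mult_ac)
  have contF: "continuous_on (sphere 0 \<rho>) F"
    using F by (intro continuous_at_imp_continuous_on ballI) (auto intro: DERIV_isCont)
  have "((\<lambda>t. F (\<gamma> t) / \<gamma> t ^ n) has_vector_derivative
      2 * pi * \<i> * (G (\<gamma> t) / \<gamma> t ^ n - n * (F (\<gamma> t) / \<gamma> t ^ n))) (at t within {0..1})" for t
  proof -
    have "((\<lambda>s. F s / s ^ n) has_field_derivative
        G (\<gamma> t) / \<gamma> t / \<gamma> t ^ n - n * F (\<gamma> t) * 1 / \<gamma> t ^ (n + 1)) (at (\<gamma> t))"
      using has_field_derivative_divide_power[OF F[OF \<gamma>(1)] DERIV_ident \<gamma>(2)] by simp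
    from field_vector_diff_chain_within[OF d\<gamma> DERIV_subset[OF this subset_UNIV]]
    have "((\<lambda>t. F (\<gamma> t) / \<gamma> t ^ n) has_vector_derivative 2 * pi * \<i> * \<gamma> t *
        (G (\<gamma> t) / \<gamma> t / \<gamma> t ^ n - n * F (\<gamma> t) * 1 / \<gamma> t ^ (n + 1))) (at t within {0..1})"
      by (simp add: o_def)
    moreover have "2 * pi * \<i> * \<gamma> t * (G (\<gamma> t) / \<gamma> t / \<gamma> t ^ n - n * F (\<gamma> t) * 1 / \<gamma> t ^ (n + 1))
        = 2 * pi * \<i> * (G (\<gamma> t) / \<gamma> t ^ n - n * (F (\<gamma> t) / \<gamma> t ^ n))"
      using \<gamma>(2)[of t] by (simp add: field_simps)
    ultimately show ?thesis by (simp only:)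
  qed
  then have "((\<lambda>t. 2 * pi * \<i> * (G (\<gamma> t) / \<gamma> t ^ n - n * (F (\<gamma> t) / \<gamma> t ^ n))) has_integral
      F (\<gamma> 1) / \<gamma> 1 ^ n - F (\<gamma> 0) / \<gamma> 0 ^ n) {0..1}"
    by (intro fundamental_theorem_of_calculus) auto
  moreover have "F (\<gamma> 1) / \<gamma> 1 ^ n - F (\<gamma> 0) / \<gamma> 0 ^ n = 0" by (simp add: \<gamma>_def circlepath)
  ultimately have "integral {0..1} (\<lambda>t. 2 * pi * \<i> * (G (\<gamma> t) / \<gamma> t ^ n - n * (F (\<gamma> t) / \<gamma> t ^ n))) = 0"
    by (simp only: integral_unique)
  then have "2 * pi * \<i> * integral {0..1} (\<lambda>t. G (\<gamma> t) / \<gamma> t ^ n - n * (F (\<gamma> t) / \<gamma> t ^ n)) = 0"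
    by (simp only: integral_mult_right)
  then have "integral {0..1} (\<lambda>t. G (\<gamma> t) / \<gamma> t ^ n - n * (F (\<gamma> t) / \<gamma> t ^ n)) = 0"
    by simp
  moreover have "(\<lambda>t. G (\<gamma> t) / \<gamma> t ^ n) integrable_on {0..1}" "(\<lambda>t. F (\<gamma> t) / \<gamma> t ^ n) integrable_on {0..1}"
    unfolding \<gamma>_def by (intro circle_mean_integrable G contF assms(1))+
  ultimately have "integral {0..1} (\<lambda>t. G (\<gamma> t) / \<gamma> t ^ n)
      - n * integral {0..1} (\<lambda>t. F (\<gamma> t) / \<gamma> t ^ n) = 0"
    by (subst (asm) integral_diff) (auto simp only: integral_mult_right intro: integrable_on_mult_right)
  then show ?thesis
    unfolding circle_mean_def \<gamma>_def[symmetric] by simp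
qed

lemma circle_mean_eq_Taylor_coeff:
  assumes "F holomorphic_on ball 0 r" "0 < \<rho>" "\<rho> < r"
  shows "circle_mean \<rho> n F = (deriv ^^ n) F 0 / fact n"
proof -
  define \<gamma> where "\<gamma> = circlepath 0 \<rho>"
  have \<gamma>: "\<gamma> t \<noteq> 0" for t using assms(2) by (simp add: \<gamma>_def circlepath)
  have sub: "cball 0 \<rho> \<subseteq> ball (0::complex) r" using assms(3) by auto
  have "((\<lambda>u. F u / (u - 0) ^ Suc n) has_contour_integral 2 * pi * \<i> / fact n * (deriv ^^ n) F 0) \<gamma>"
    unfolding \<gamma>_def
  proof (rule Cauchy_has_contour_integral_higher_derivative_circlepath)
    show "continuous_on (cball 0 \<rho>) F"
      using assms(1) holomorphic_on_imp_continuous_on holomorphic_on_subset sub by blast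
    show "F holomorphic_on ball 0 \<rho>"
      using assms(1) holomorphic_on_subset sub ball_subset_cball by blast
  qed (use assms in auto)
  then have "((\<lambda>t. F (\<gamma> t) / (\<gamma> t - 0) ^ Suc n * vector_derivative \<gamma> (at t within {0..1}))
      has_integral 2 * pi * \<i> / fact n * (deriv ^^ n) F 0) {0..1}"
    unfolding has_contour_integral_def .
  moreover have "F (\<gamma> t) / (\<gamma> t - 0) ^ Suc n * vector_derivative \<gamma> (at t within {0..1})
      = 2 * pi * \<i> * (F (\<gamma> t) / \<gamma> t ^ n)" if "t \<in> {0..1}" for t
  proof -
    have "vector_derivative \<gamma> (at t within {0..1}) = 2 * pi * \<i> * \<gamma> t"
      using that vector_derivative_circlepath01[of t 0 \<rho>] by (simp add: \<gamma>_def circlepath mult_ac)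
    then show ?thesis using \<gamma>[of t] by simp
  qed
  ultimately have "((\<lambda>t. 2 * pi * \<i> * (F (\<gamma> t) / \<gamma> t ^ n)) has_integral
      2 * pi * \<i> / fact n * (deriv ^^ n) F 0) {0..1}"
    using has_integral_cong by (metis (no_types, lifting))
  then have "((\<lambda>t. 2 * pi * \<i> * (F (\<gamma> t) / \<gamma> t ^ n)) has_integral
      2 * pi * \<i> * ((deriv ^^ n) F 0 / fact n)) {0..1}"
    by simp
  then have "((\<lambda>t. F (\<gamma> t) / \<gamma> t ^ n) has_integral (deriv ^^ n) F 0 / fact n) {0..1}"
    by (subst (asm) has_integral_mult_right_iff) auto
  then show ?thesis unfolding circle_mean_def \<gamma>_def[symmetric] by (rule integral_unique)
qed

lemma continuous_on_circle_mean_integrand: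
  assumes "continuous_on (P \<times> sphere 0 \<rho>) (\<lambda>(p, s). F p s)" "0 < \<rho>"
  shows "continuous_on (P \<times> {0..1}) (\<lambda>(p, t). F p (circlepath 0 \<rho> t) / circlepath 0 \<rho> t ^ n)"
proof -
  have "continuous_on (P \<times> {0..1}) (\<lambda>z. circlepath 0 \<rho> (snd z))"
    unfolding circlepath by (intro continuous_intros)
  moreover from this have "continuous_on (P \<times> {0..1}) (\<lambda>z. F (fst z) (circlepath 0 \<rho> (snd z)))"
    using assms(2) circlepath_in_sphere[of \<rho>]
    by (intro continuous_on_compose2[OF assms(1), of _ "\<lambda>z. (fst z, circlepath 0 \<rho> (snd z))",
          unfolded case_prod_conv] continuous_intros) auto
  moreover have "circlepath 0 \<rho> t \<noteq> 0" for t using assms(2) by (simp add: circlepath)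
  ultimately show ?thesis
    unfolding case_prod_unfold by (intro continuous_intros) auto
qed

lemma continuous_on_circle_mean:
  assumes "continuous_on (P \<times> sphere 0 \<rho>) (\<lambda>(p, s). F p s)" "0 < \<rho>"
  shows "continuous_on P (\<lambda>p. circle_mean \<rho> n (F p))"
  using integral_continuous_on_param[of P 0 "1::real",
      unfolded cbox_interval, OF continuous_on_circle_mean_integrand[OF assms]]
  unfolding circle_mean_def .

lemma circle_mean_has_field_derivative:
  assumes "open U" "convex U" "a \<in> U" "0 < \<rho>"
    and F: "\<And>a s. a \<in> U \<Longrightarrow> norm s = \<rho> \<Longrightarrow> ((\<lambda>a. F a s) has_field_derivative F' a s) (at a)"
    and contF: "\<And>a. a \<in> U \<Longrightarrow> continuous_on (sphere 0 \<rho>) (F a)"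
    and contF': "continuous_on (U \<times> sphere 0 \<rho>) (\<lambda>(a, s). F' a s)"
  shows "((\<lambda>a. circle_mean \<rho> n (F a)) has_field_derivative circle_mean \<rho> n (F' a)) (at a)"
proof -
  have "((\<lambda>a. integral (cbox 0 1) (\<lambda>t. F a (circlepath 0 \<rho> t) / circlepath 0 \<rho> t ^ n))
      has_field_derivative integral (cbox 0 1) (\<lambda>t. F' a (circlepath 0 \<rho> t) / circlepath 0 \<rho> t ^ n))
      (at a within U)"
  proof (rule leibniz_rule_field_derivative)
    show "((\<lambda>a. F a (circlepath 0 \<rho> t) / circlepath 0 \<rho> t ^ n) has_field_derivative
        F' a (circlepath 0 \<rho> t) / circlepath 0 \<rho> t ^ n) (at a within U)" if "a \<in> U" for a t
      using F[OF that] circlepath_in_sphere[of \<rho> t] assms(4)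
      by (intro DERIV_cdivide) (auto intro: has_field_derivative_at_within)
    show "(\<lambda>t. F a (circlepath 0 \<rho> t) / circlepath 0 \<rho> t ^ n) integrable_on cbox 0 1" if "a \<in> U" for a
      using circle_mean_integrable[OF contF[OF that] assms(4)] by simp
    show "continuous_on (U \<times> cbox 0 1) (\<lambda>(a, t). F' a (circlepath 0 \<rho> t) / circlepath 0 \<rho> t ^ n)"
      using continuous_on_circle_mean_integrand[OF contF' assms(4)] by simp
  qed (rule assms(2,3))+
  then show ?thesis
    unfolding circle_mean_def at_within_open[OF assms(3,1)] cbox_interval .
qed

section \<open>The coefficients of the expansion at infinity\<close>

text \<open>On the circle of radius \<open>1/(4r)\<close> the wave is regular for all complex \<open>a\<close> with \<open>|a| \<le> r\<close>
  and all \<open>0 \<le> B \<le> r\<^sup>2\<close>.\<close>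

definition far_coeff :: "real \<Rightarrow> real \<Rightarrow> nat \<Rightarrow> complex \<Rightarrow> real \<Rightarrow> complex" where
  "far_coeff r \<kappa> n a B = circle_mean (1 / (4 * r)) n (wave \<kappa> 1 a B)"

definition far_coeff_a :: "real \<Rightarrow> real \<Rightarrow> nat \<Rightarrow> complex \<Rightarrow> real \<Rightarrow> complex" where
  "far_coeff_a r \<kappa> n a B = circle_mean (1 / (4 * r)) n (wave_a \<kappa> a B)"

definition far_coeff_aa :: "real \<Rightarrow> real \<Rightarrow> nat \<Rightarrow> complex \<Rightarrow> real \<Rightarrow> complex" where
  "far_coeff_aa r \<kappa> n a B = circle_mean (1 / (4 * r)) n (wave_aa \<kappa> a B)"

lemma small_circle_domain:
  assumes "norm a \<le> r" "0 \<le> B" "B \<le> r\<^sup>2" "norm s = 1 / (4 * r)" "0 < r"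
  shows "rel_sq a B s \<notin> \<real>\<^sub>\<le>\<^sub>0" "s \<noteq> 0"
proof -
  have "norm s * r = 1 / 4" using assms(4,5) by simp
  then show "rel_sq a B s \<notin> \<real>\<^sub>\<le>\<^sub>0" by (intro rel_sq_domain_small[OF assms(1-3)]) simp
  show "s \<noteq> 0" using assms(4,5) by auto
qed

lemma continuous_on_waves:
  assumes "0 < r" "continuous_on S a" "continuous_on S B" "continuous_on S s"
    and "\<And>p. p \<in> S \<Longrightarrow> norm (a p) \<le> r" "\<And>p. p \<in> S \<Longrightarrow> 0 \<le> B p" "\<And>p. p \<in> S \<Longrightarrow> B p \<le> r\<^sup>2"
    and "\<And>p. p \<in> S \<Longrightarrow> norm (s p) = 1 / (4 * r)"
  shows "continuous_on S (\<lambda>p. wave \<kappa> m (a p) (B p) (s p))"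
    and "continuous_on S (\<lambda>p. wave_a \<kappa> (a p) (B p) (s p))"
    and "continuous_on S (\<lambda>p. wave_aa \<kappa> (a p) (B p) (s p))"
    and "continuous_on S (\<lambda>p. wave_radial \<kappa> (a p) (B p) (s p))"
proof -
  have dom: "rel_sq (a p) (B p) (s p) \<notin> \<real>\<^sub>\<le>\<^sub>0" "s p \<noteq> 0" if "p \<in> S" for p
    using small_circle_domain[OF assms(5,6,7,8)[OF that] assms(1)] by auto
  have w: "continuous_on S (\<lambda>p. wave \<kappa> m (a p) (B p) (s p))" for m
    by (rule continuous_on_wave[OF assms(2-4) dom(1)])
  note c = w assms(2-4)
  show "continuous_on S (\<lambda>p. wave \<kappa> m (a p) (B p) (s p))" by (rule w)
  show "continuous_on S (\<lambda>p. wave_a \<kappa> (a p) (B p) (s p))"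
    unfolding wave_a_def by (intro continuous_intros c)
  show "continuous_on S (\<lambda>p. wave_aa \<kappa> (a p) (B p) (s p))"
    unfolding wave_aa_def by (intro continuous_intros c)
  show "continuous_on S (\<lambda>p. wave_radial \<kappa> (a p) (B p) (s p))"
    unfolding wave_radial_def by (intro continuous_intros c ballI) (use dom in auto)
qed

lemma far_coeff_derivatives:
  assumes "0 < r" "norm a < r" "0 \<le> B" "B \<le> r\<^sup>2"
  shows "((\<lambda>a. far_coeff r \<kappa> n a B) has_field_derivative far_coeff_a r \<kappa> n a B) (at a)"
    and "((\<lambda>a. far_coeff_a r \<kappa> n a B) has_field_derivative far_coeff_aa r \<kappa> n a B) (at a)"
proof -
  define U where "U = ball (0::complex) r"
  have U: "open U" "convex U" "a \<in> U" "0 < 1 / (4 * r)"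
    using assms by (auto simp: U_def)
  have dom: "rel_sq a B s \<notin> \<real>\<^sub>\<le>\<^sub>0" if "a \<in> U" "norm s = 1 / (4 * r)" for a s
    using small_circle_domain(1)[of a r B s] that assms by (simp add: U_def)
  have c1: "continuous_on (sphere 0 (1 / (4 * r))) (wave \<kappa> 1 a B)"
    "continuous_on (sphere 0 (1 / (4 * r))) (wave_a \<kappa> a B)" if "a \<in> U" for a
    using that assms unfolding U_def by (auto intro!: continuous_on_waves[of r] continuous_intros)
  have c2: "continuous_on (U \<times> sphere 0 (1 / (4 * r))) (\<lambda>(a, s). wave_a \<kappa> a B s)"
    "continuous_on (U \<times> sphere 0 (1 / (4 * r))) (\<lambda>(a, s). wave_aa \<kappa> a B s)"
    using assms unfolding U_def case_prod_unfold
    by (auto intro!: continuous_on_waves[of r] continuous_intros)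
  show "((\<lambda>a. far_coeff r \<kappa> n a B) has_field_derivative far_coeff_a r \<kappa> n a B) (at a)"
    unfolding far_coeff_def far_coeff_a_def
    by (rule circle_mean_has_field_derivative[OF U wave_derivatives(1)[OF dom] c1(1) c2(1)])
  show "((\<lambda>a. far_coeff_a r \<kappa> n a B) has_field_derivative far_coeff_aa r \<kappa> n a B) (at a)"
    unfolding far_coeff_aa_def far_coeff_a_def
    by (rule circle_mean_has_field_derivative[OF U wave_derivatives(2)[OF dom] c1(2) c2(2)])
qed

lemma far_coeff_continuous:
  assumes "0 < r" "continuous_on S a" "continuous_on S B"
    and "\<And>p. p \<in> S \<Longrightarrow> norm (a p) \<le> r" "\<And>p. p \<in> S \<Longrightarrow> 0 \<le> B p" "\<And>p. p \<in> S \<Longrightarrow> B p \<le> r\<^sup>2"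
  shows "continuous_on S (\<lambda>p. far_coeff r \<kappa> n (a p) (B p))"
    and "continuous_on S (\<lambda>p. far_coeff_a r \<kappa> n (a p) (B p))"
    and "continuous_on S (\<lambda>p. far_coeff_aa r \<kappa> n (a p) (B p))"
proof -
  have c: "continuous_on (S \<times> sphere 0 (1 / (4 * r))) (\<lambda>z. a (fst z))"
    "continuous_on (S \<times> sphere 0 (1 / (4 * r))) (\<lambda>z. B (fst z))"
    by (auto intro!: continuous_on_compose2[OF assms(2)] continuous_on_compose2[OF assms(3)]
        continuous_intros)
  note w = continuous_on_waves[OF assms(1) c continuous_on_snd[OF continuous_on_id], of \<kappa>]
  show "continuous_on S (\<lambda>p. far_coeff r \<kappa> n (a p) (B p))"
    unfolding far_coeff_def
    by (intro continuous_on_circle_mean) (use assms w(1) in \<open>auto simp: case_prod_unfold\<close>)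
  show "continuous_on S (\<lambda>p. far_coeff_a r \<kappa> n (a p) (B p))"
    unfolding far_coeff_a_def
    by (intro continuous_on_circle_mean) (use assms w(2) in \<open>auto simp: case_prod_unfold\<close>)
  show "continuous_on S (\<lambda>p. far_coeff_aa r \<kappa> n (a p) (B p))"
    unfolding far_coeff_aa_def
    by (intro continuous_on_circle_mean) (use assms w(3) in \<open>auto simp: case_prod_unfold\<close>)
qed

text \<open>The wave equation, coefficient by coefficient: \<open>s d/ds\<close> becomes multiplication by \<open>n\<close>,
  and division by \<open>s\<close> a shift of the index.\<close>

lemma far_coeff_recursion:
  assumes "0 < r" "norm a \<le> r" "0 \<le> B" "B \<le> r\<^sup>2"
  shows "2 * \<i> * \<kappa> * of_nat (n + 1) * far_coeff r \<kappa> (n + 1) a B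
    = of_nat (n * (n + 1)) * far_coeff r \<kappa> n a B
      + ((B - a\<^sup>2) * far_coeff_aa r \<kappa> n a B - 2 * a * far_coeff_a r \<kappa> n a B)"
proof -
  define \<rho> where "\<rho> = 1 / (4 * r)"
  have \<rho>: "0 < \<rho>" using assms(1) by (simp add: \<rho>_def)
  have dom: "rel_sq a B s \<notin> \<real>\<^sub>\<le>\<^sub>0" "s \<noteq> 0" if "norm s = \<rho>" for s
    using small_circle_domain[OF assms(2-4) _ assms(1)] that by (auto simp: \<rho>_def)
  have cont: "continuous_on (sphere 0 \<rho>) (wave_a \<kappa> a B)"
    "continuous_on (sphere 0 \<rho>) (wave_aa \<kappa> a B)" "continuous_on (sphere 0 \<rho>) (wave_radial \<kappa> a B)"
    using assms by (auto simp: \<rho>_def intro!: continuous_on_waves[of r] continuous_intros)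
  have cont': "continuous_on (sphere 0 \<rho>) (\<lambda>s. wave_radial \<kappa> a B s / s)"
    by (intro continuous_intros cont) (use \<rho> in auto)
  define G where "G s = 2 * \<i> * \<kappa> * (wave_radial \<kappa> a B s / s) + (- 1) * wave_radial \<kappa> a B s
      + (- (B - a\<^sup>2)) * wave_aa \<kappa> a B s + 2 * a * wave_a \<kappa> a B s" for s
  have G: "continuous_on (sphere 0 \<rho>) G"
    unfolding G_def by (intro continuous_intros cont cont')
  have radial: "circle_mean \<rho> m (wave_radial \<kappa> a B) = of_nat m * far_coeff r \<kappa> m a B" for m
    unfolding far_coeff_def \<rho>_def[symmetric]
    by (rule circle_mean_Euler[OF \<rho> wave_derivatives(3)[OF dom(1,2)] cont(3)])
  have "circle_mean \<rho> n G = of_nat n * circle_mean \<rho> n (wave_radial \<kappa> a B)"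
  proof (rule circle_mean_Euler[OF \<rho> _ G])
    fix s :: complex assume "norm s = \<rho>"
    then show "(wave_radial \<kappa> a B has_field_derivative G s / s) (at s)"
      using wave_equation[OF dom, of s \<kappa>] by (simp add: G_def algebra_simps)
  qed
  moreover have "circle_mean \<rho> n G = 2 * \<i> * \<kappa> * circle_mean \<rho> (Suc n) (wave_radial \<kappa> a B)
      + (- 1) * circle_mean \<rho> n (wave_radial \<kappa> a B)
      + (- (B - a\<^sup>2)) * circle_mean \<rho> n (wave_aa \<kappa> a B) + 2 * a * circle_mean \<rho> n (wave_a \<kappa> a B)"
    unfolding G_def
    by (simp only: circle_mean_add circle_mean_cmult circle_mean_shift continuous_on_add
        continuous_on_mult_left cont cont' \<rho>)
  ultimately show ?thesis
    unfolding radial far_coeff_a_def far_coeff_aa_def \<rho>_def[symmetric]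
    by (simp add: algebra_simps)
qed

text \<open>The mean over the small circle is a Taylor coefficient at \<open>0\<close>, whereas for real \<open>a\<close> with
  \<open>a\<^sup>2 \<le> B \<le> r\<^sub>1\<^sup>2\<close> the wave is holomorphic in the disc of radius \<open>1/r\<^sub>1\<close>. Hence the series converges,
  with uniform bounds, for all radii larger than \<open>r\<^sub>1\<close>.\<close>

lemma far_coeff_sums:
  assumes "0 < r1" "r1 < r2" "r1 \<le> r"
  obtains C where "0 \<le> C"
    and "\<And>a B n. a\<^sup>2 \<le> B \<Longrightarrow> B \<le> r1\<^sup>2 \<Longrightarrow> norm (far_coeff r \<kappa> n (of_real a) B) \<le> C * r2 ^ n"
    and "\<And>a B s. a\<^sup>2 \<le> B \<Longrightarrow> B \<le> r1\<^sup>2 \<Longrightarrow> norm s < 1 / r1 \<Longrightarrow>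
      (\<lambda>n. far_coeff r \<kappa> n (of_real a) B * s ^ n) sums wave \<kappa> 1 (of_real a) B s"
proof -
  define \<rho> where "\<rho> = 1 / r2"
  have \<rho>: "0 < \<rho>" "\<rho> < 1 / r1" using assms by (auto simp: \<rho>_def divide_strict_left_mono)
  have dom: "rel_sq (of_real a) B s \<notin> \<real>\<^sub>\<le>\<^sub>0" if "a\<^sup>2 \<le> B" "B \<le> r1\<^sup>2" "norm s < 1 / r1" for a B s
  proof (rule rel_sq_domain[OF that(1)])
    have "norm s * r1 < 1" using that(3) assms(1) by (simp add: field_simps)
    then have "(norm s * r1)\<^sup>2 < 1" using assms(1) by (simp add: abs_square_less_1)
    moreover have "B * (norm s)\<^sup>2 \<le> r1\<^sup>2 * (norm s)\<^sup>2" using that(2) by (simp add: mult_right_mono)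
    ultimately show "B * (norm s)\<^sup>2 < 1" by (simp add: power_mult_distrib mult.commute)
  qed
  have hol: "wave \<kappa> 1 (of_real a) B holomorphic_on ball 0 (1 / r1)" if "a\<^sup>2 \<le> B" "B \<le> r1\<^sup>2" for a B
    using dom[OF that] by (intro holomorphic_on_wave) auto
  have coeff: "far_coeff r \<kappa> n (of_real a) B = (deriv ^^ n) (wave \<kappa> 1 (of_real a) B) 0 / fact n"
    if "a\<^sup>2 \<le> B" "B \<le> r1\<^sup>2" for a B n
    unfolding far_coeff_def using assms
    by (intro circle_mean_eq_Taylor_coeff[OF hol[OF that]]) (auto simp: field_simps)
  define K where "K = (cbox (- r1) r1 \<times> cbox 0 (r1\<^sup>2) \<times> cball (0::complex) \<rho>) \<inter> {p. (fst p)\<^sup>2 \<le> fst (snd p)}"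
  have "compact K"
    unfolding K_def
    by (intro compact_Int_closed compact_Times compact_cbox compact_cball closed_Collect_le continuous_intros)
  moreover have "continuous_on K (\<lambda>p. wave \<kappa> 1 (of_real (fst p)) (fst (snd p)) (snd (snd p)))"
    using dom \<rho> by (intro continuous_on_wave continuous_intros) (auto simp: K_def)
  ultimately have "bounded ((\<lambda>p. wave \<kappa> 1 (of_real (fst p)) (fst (snd p)) (snd (snd p))) ` K)"
    by (intro compact_imp_bounded compact_continuous_image)
  then obtain C where C: "\<And>p. p \<in> K \<Longrightarrow> norm (wave \<kappa> 1 (of_real (fst p)) (fst (snd p)) (snd (snd p))) \<le> C"
    unfolding bounded_iff by blast
  have K: "(a, B, s) \<in> K" if "a\<^sup>2 \<le> B" "B \<le> r1\<^sup>2" "norm s \<le> \<rho>" for a B s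
  proof -
    have "a\<^sup>2 \<le> r1\<^sup>2" using that by linarith
    then have "\<bar>a\<bar> \<le> r1" using assms(1) by (simp add: abs_le_square_iff[symmetric])
    moreover have "0 \<le> B" using that(1) zero_le_power2 order_trans by blast
    ultimately show ?thesis using that by (auto simp: K_def)
  qed
  show thesis
  proof (rule that)
    have "(0, 0, 0) \<in> K" using K[of 0 0 0] assms(1) \<rho> by simp
    then show "0 \<le> C" using C norm_ge_zero order_trans by blast
    fix a B :: real assume aB: "a\<^sup>2 \<le> B" "B \<le> r1\<^sup>2"
    show "norm (far_coeff r \<kappa> n (of_real a) B) \<le> C * r2 ^ n" for n
    proof -
      have "norm ((deriv ^^ n) (wave \<kappa> 1 (of_real a) B) 0) \<le> fact n * C / \<rho> ^ n"
      proof (rule Cauchy_inequality)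
        show "wave \<kappa> 1 (of_real a) B holomorphic_on ball 0 \<rho>"
          using hol[OF aB] by (rule holomorphic_on_subset) (use \<rho> in auto)
        show "continuous_on (cball 0 \<rho>) (wave \<kappa> 1 (of_real a) B)"
          by (rule holomorphic_on_imp_continuous_on, rule holomorphic_on_subset[OF hol[OF aB]])
            (use \<rho> in auto)
        show "norm (wave \<kappa> 1 (of_real a) B s) \<le> C" if "norm (0 - s) = \<rho>" for s
          using C[OF K[OF aB, of s]] that by simp
      qed (fact \<rho>)
      then show ?thesis
        unfolding coeff[OF aB] by (simp add: norm_divide \<rho>_def field_simps)
    qed
    fix s :: complex assume "norm s < 1 / r1"
    then show "(\<lambda>n. far_coeff r \<kappa> n (of_real a) B * s ^ n) sums wave \<kappa> 1 (of_real a) B s"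
      using holomorphic_power_series[OF hol[OF aB], of s] unfolding coeff[OF aB] by simp
  qed
qed

section \<open>Rellich's lemma for the Helmholtz potential\<close>

lemma integrable_bounded_mult:
  fixes f w :: "'a \<Rightarrow> complex"
  assumes "integrable M f" "w \<in> borel_measurable M" "\<And>y. y \<in> space M \<Longrightarrow> norm (w y) \<le> C"
  shows "integrable M (\<lambda>y. w y * f y)"
proof (rule Bochner_Integration.integrable_bound)
  show "integrable M (\<lambda>y. C * norm (f y))" using assms(1) by simp
  show "(\<lambda>y. w y * f y) \<in> borel_measurable M" using assms(1,2) by measurable
  show "AE y in M. norm (w y * f y) \<le> norm (C * norm (f y))"
  proof (rule AE_I2)
    fix y assume "y \<in> space M"
    then have "norm (w y) \<le> \<bar>C\<bar>" using assms(3)[of y] by linarith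
    then show "norm (w y * f y) \<le> norm (C * norm (f y))"
      by (simp add: norm_mult abs_mult mult_right_mono)
  qed
qed

text \<open>The difference quotients in \<open>t\<close> integrate to \<open>0\<close> and are bounded by \<open>C |f|\<close>, so the
  limit integrates to \<open>0\<close> by dominated convergence. Measurability of \<open>w'\<close> is part of the conclusion
  because the lemma is applied to \<open>w'\<close> in turn.\<close>

lemma integral_derivative_vanishes:
  fixes f :: "'a \<Rightarrow> complex" and w w' :: "real \<Rightarrow> 'a \<Rightarrow> complex"
  assumes f: "integrable M f"
    and w: "\<And>t. w t \<in> borel_measurable M" "\<And>t y. y \<in> space M \<Longrightarrow> norm (w t y) \<le> C"
    and w': "\<And>t y. y \<in> space M \<Longrightarrow> ((\<lambda>t. w t y) has_vector_derivative w' t y) (at t)"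
      "\<And>t y. y \<in> space M \<Longrightarrow> norm (w' t y) \<le> C"
    and zero: "\<And>t. (\<integral>y. w t y * f y \<partial>M) = 0"
  shows "(\<integral>y. w' t y * f y \<partial>M) = 0" and "w' t \<in> borel_measurable M"
proof -
  define h :: "nat \<Rightarrow> real" where "h k = inverse (real (Suc k))" for k
  have h: "h k > 0" for k by (simp add: h_def)
  have "filterlim h (at 0) sequentially"
    unfolding filterlim_at using LIMSEQ_inverse_real_of_nat by (auto simp: h_def[abs_def])
  note h_lim = this
  define d where "d k y = inverse (h k) *\<^sub>R (w (t + h k) y - w t y)" for k y
  have d_lim: "(\<lambda>k. d k y) \<longlonglongrightarrow> w' t y" if "y \<in> space M" for y
  proof -
    have "((\<lambda>x. (w (t + x) y - w t y) /\<^sub>R x) \<longlongrightarrow> w' t y) (at 0)"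
    proof (rule LIM_zero_cancel, rule tendsto_norm_zero_cancel)
      have lim: "((\<lambda>x. norm (w (t + x) y - w t y - x *\<^sub>R w' t y) / norm x) \<longlongrightarrow> 0) (at 0)"
        using w'(1)[OF that, of t] by (simp add: has_vector_derivative_def has_derivative_at)
      have *: "norm (w (t + x) y - w t y - x *\<^sub>R w' t y) / norm x
          = norm ((w (t + x) y - w t y) /\<^sub>R x - w' t y)" if "x \<noteq> 0" for x
      proof -
        have "w (t + x) y - w t y - x *\<^sub>R w' t y = x *\<^sub>R ((w (t + x) y - w t y) /\<^sub>R x - w' t y)"
          using that by (simp add: scaleR_diff_right)
        then show ?thesis using that by (metis nonzero_mult_div_cancel_left norm_eq_zero norm_scaleR real_norm_def)
      qed
      have "\<forall>\<^sub>F x in at 0. norm (w (t + x) y - w t y - x *\<^sub>R w' t y) / norm x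
          = norm ((w (t + x) y - w t y) /\<^sub>R x - w' t y)"
        using * by (simp add: eventually_at_filter)
      with lim show "((\<lambda>x. norm ((w (t + x) y - w t y) /\<^sub>R x - w' t y)) \<longlongrightarrow> 0) (at 0)"
        by (rule Lim_transform_eventually)
    qed
    from filterlim_compose[OF this h_lim] show ?thesis by (simp add: d_def)
  qed
  have d_meas: "d k \<in> borel_measurable M" for k
    unfolding d_def using w(1) by measurable
  have d_bound: "norm (d k y) \<le> C" if "y \<in> space M" for k y
  proof -
    have "norm (w (t + h k) y - w t y) \<le> C * norm (t + h k - t)"
    proof (rule differentiable_bound[where S = UNIV and f' = "\<lambda>t u. u *\<^sub>R w' t y"])
      show "((\<lambda>t. w t y) has_derivative (\<lambda>u. u *\<^sub>R w' t y)) (at t within UNIV)" for t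
        using w'(1)[OF that] by (simp add: has_vector_derivative_def)
      show "onorm (\<lambda>u. u *\<^sub>R w' t y) \<le> C" for t
        using mult_left_mono[OF w'(2)[OF that, of t] abs_ge_zero]
        by (intro onorm_le) (simp add: mult.commute)
    qed auto
    then show ?thesis
      using h[of k] unfolding d_def norm_scaleR by (simp add: field_simps)
  qed
  show meas: "w' t \<in> borel_measurable M"
    by (rule borel_measurable_LIMSEQ_metric[OF d_meas d_lim])
  have "(\<lambda>k. \<integral>y. d k y * f y \<partial>M) \<longlonglongrightarrow> (\<integral>y. w' t y * f y \<partial>M)"
  proof (rule integral_dominated_convergence)
    show "(\<lambda>y. w' t y * f y) \<in> borel_measurable M" "(\<lambda>y. d k y * f y) \<in> borel_measurable M" for k
      using meas d_meas f by measurable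
    show "integrable M (\<lambda>y. C * norm (f y))" using f by simp
    show "AE y in M. (\<lambda>k. d k y * f y) \<longlonglongrightarrow> w' t y * f y"
      by (intro AE_I2 tendsto_intros d_lim)
    show "AE y in M. norm (d k y * f y) \<le> C * norm (f y)" for k
      by (intro AE_I2) (simp add: norm_mult d_bound mult_right_mono)
  qed
  moreover have "(\<integral>y. d k y * f y \<partial>M) = 0" for k
  proof -
    have "(\<integral>y. d k y * f y \<partial>M) = (\<integral>y. inverse (h k) *\<^sub>R (w (t + h k) y * f y - w t y * f y) \<partial>M)"
      by (intro Bochner_Integration.integral_cong) (auto simp: d_def algebra_simps)
    also have "\<dots> = inverse (h k) *\<^sub>R ((\<integral>y. w (t + h k) y * f y \<partial>M) - (\<integral>y. w t y * f y \<partial>M))"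
      using integrable_bounded_mult[OF f w] by simp
    finally show ?thesis by (simp add: zero)
  qed
  ultimately show "(\<integral>y. w' t y * f y \<partial>M) = 0"
    using LIMSEQ_unique[OF _ tendsto_const] by simp
qed

text \<open>The coefficient of \<open>1/|x|\<^sup>n\<close> in the expansion of the potential of \<open>f\<close>, up to the factor \<open>4\<pi>\<close>.
  The parameter \<open>3r\<close> makes the coefficients of the kernel differentiable on a neighbourhood of the
  values \<open>|\<theta> \<bullet> y| \<le> r\<close>.\<close>

definition far_field_coeff ::
  "real \<Rightarrow> real \<Rightarrow> (real^3 \<Rightarrow> complex) \<Rightarrow> nat \<Rightarrow> real^3 \<Rightarrow> complex" where
  "far_field_coeff r \<kappa> f n \<theta> =
     (LINT y|lebesgue_on (cball 0 r). far_coeff (3 * r) \<kappa> n (of_real (\<theta> \<bullet> y)) ((norm y)\<^sup>2) * f y)"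

lemma measurable_far_coeff:
  fixes \<alpha> :: "real^3 \<Rightarrow> real"
  assumes "0 < r" "continuous_on UNIV \<alpha>" "\<And>y. y \<in> cball 0 r \<Longrightarrow> \<bar>\<alpha> y\<bar> \<le> 2 * r"
  shows "(\<lambda>y. far_coeff (3 * r) \<kappa> n (of_real (\<alpha> y)) ((norm y)\<^sup>2)) \<in> borel_measurable (lebesgue_on (cball 0 r))"
    and "(\<lambda>y. far_coeff_a (3 * r) \<kappa> n (of_real (\<alpha> y)) ((norm y)\<^sup>2)) \<in> borel_measurable (lebesgue_on (cball 0 r))"
    and "(\<lambda>y. far_coeff_aa (3 * r) \<kappa> n (of_real (\<alpha> y)) ((norm y)\<^sup>2)) \<in> borel_measurable (lebesgue_on (cball 0 r))"
proof -
  have "continuous_on (cball 0 r) \<alpha>" using assms(2) continuous_on_subset by blast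
  then have c1: "continuous_on (cball 0 r) (\<lambda>y. complex_of_real (\<alpha> y))"
    by (rule continuous_on_of_real)
  have c2: "continuous_on (cball 0 r) (\<lambda>y::real^3. (norm y)\<^sup>2)"
    by (intro continuous_intros)
  have "norm y ^ 2 \<le> (3 * r)\<^sup>2" if "y \<in> cball 0 r" for y :: "real^3"
    using that assms(1) by (intro power_mono) auto
  moreover have "\<bar>\<alpha> y\<bar> \<le> 3 * r" if "y \<in> cball 0 r" for y
    using assms(3)[OF that] assms(1) by linarith
  ultimately show
    "(\<lambda>y. far_coeff (3 * r) \<kappa> n (of_real (\<alpha> y)) ((norm y)\<^sup>2)) \<in> borel_measurable (lebesgue_on (cball 0 r))"
    "(\<lambda>y. far_coeff_a (3 * r) \<kappa> n (of_real (\<alpha> y)) ((norm y)\<^sup>2)) \<in> borel_measurable (lebesgue_on (cball 0 r))"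
    "(\<lambda>y. far_coeff_aa (3 * r) \<kappa> n (of_real (\<alpha> y)) ((norm y)\<^sup>2)) \<in> borel_measurable (lebesgue_on (cball 0 r))"
    using assms(1)
    by (intro continuous_imp_measurable_on_sets_lebesgue far_coeff_continuous[OF _ c1 c2]; simp)+
qed

lemma far_coeff_bounded:
  assumes "0 < r"
  obtains C where
    "\<And>a B. \<bar>a\<bar> \<le> 2 * r \<Longrightarrow> 0 \<le> B \<Longrightarrow> B \<le> r\<^sup>2 \<Longrightarrow> norm (far_coeff (3 * r) \<kappa> n (of_real a) B) \<le> C"
    "\<And>a B. \<bar>a\<bar> \<le> 2 * r \<Longrightarrow> 0 \<le> B \<Longrightarrow> B \<le> r\<^sup>2 \<Longrightarrow> norm (far_coeff_a (3 * r) \<kappa> n (of_real a) B) \<le> C"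
    "\<And>a B. \<bar>a\<bar> \<le> 2 * r \<Longrightarrow> 0 \<le> B \<Longrightarrow> B \<le> r\<^sup>2 \<Longrightarrow> norm (far_coeff_aa (3 * r) \<kappa> n (of_real a) B) \<le> C"
proof -
  define K where "K = cbox (- (2 * r)) (2 * r) \<times> cbox 0 (r\<^sup>2)"
  have K: "compact K" unfolding K_def by (intro compact_Times compact_cbox)
  have "r\<^sup>2 \<le> (3 * r)\<^sup>2" using assms by (intro power_mono) auto
  then have dom: "norm (complex_of_real (fst p)) \<le> 3 * r" "0 \<le> snd p" "snd p \<le> (3 * r)\<^sup>2" if "p \<in> K" for p
    using that assms by (auto simp: K_def)
  have c: "continuous_on K (\<lambda>p. complex_of_real (fst p))" "continuous_on K snd"
    by (intro continuous_intros)+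
  have "0 < 3 * r" using assms by simp
  note cont = far_coeff_continuous[OF this c dom, of \<kappa> n]
  have "\<exists>C. \<forall>p\<in>K. norm (g p) \<le> C" if "continuous_on K g" for g :: "real \<times> real \<Rightarrow> complex"
    using compact_imp_bounded[OF compact_continuous_image[OF that K]] unfolding bounded_iff by blast
  from this[OF cont(1)] this[OF cont(2)] this[OF cont(3)] obtain C1 C2 C3 where
    "\<forall>p\<in>K. norm (far_coeff (3 * r) \<kappa> n (of_real (fst p)) (snd p)) \<le> C1"
    "\<forall>p\<in>K. norm (far_coeff_a (3 * r) \<kappa> n (of_real (fst p)) (snd p)) \<le> C2"
    "\<forall>p\<in>K. norm (far_coeff_aa (3 * r) \<kappa> n (of_real (fst p)) (snd p)) \<le> C3"
    by blast
  note C = this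
  show thesis
  proof (rule that)
    fix a B :: real assume "\<bar>a\<bar> \<le> 2 * r" "0 \<le> B" "B \<le> r\<^sup>2"
    then have "(a, B) \<in> K" by (auto simp: K_def)
    with C show "norm (far_coeff (3 * r) \<kappa> n (of_real a) B) \<le> max C1 (max C2 C3)"
      "norm (far_coeff_a (3 * r) \<kappa> n (of_real a) B) \<le> max C1 (max C2 C3)"
      "norm (far_coeff_aa (3 * r) \<kappa> n (of_real a) B) \<le> max C1 (max C2 C3)"
      by (fastforce simp: le_max_iff_disj)+
  qed
qed

text \<open>The great circle through \<open>\<theta>\<close> in the direction \<open>e\<close> stays on the unit sphere, where the
  integral vanishes; the left-hand side is its second derivative along this circle.\<close>

lemma great_circle_derivative_vanishes:
  fixes \<theta> e :: "real^3"
  assumes "0 < r" and f: "integrable (lebesgue_on (cball 0 r)) f"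
    and zero: "\<And>\<theta>. norm \<theta> = 1 \<Longrightarrow> far_field_coeff r \<kappa> f n \<theta> = 0"
    and "norm \<theta> = 1" "norm e = 1" "\<theta> \<bullet> e = 0"
  shows "(LINT y|lebesgue_on (cball 0 r).
      (of_real ((e \<bullet> y)\<^sup>2) * far_coeff_aa (3 * r) \<kappa> n (of_real (\<theta> \<bullet> y)) ((norm y)\<^sup>2)
        - of_real (\<theta> \<bullet> y) * far_coeff_a (3 * r) \<kappa> n (of_real (\<theta> \<bullet> y)) ((norm y)\<^sup>2)) * f y) = 0"
proof -
  define M where "M = lebesgue_on (cball (0 :: real^3) r)"
  define \<alpha> where "\<alpha> t y = (cos t *\<^sub>R \<theta> + sin t *\<^sub>R e) \<bullet> y" for t y
  define \<beta> where "\<beta> t y = (cos t *\<^sub>R e - sin t *\<^sub>R \<theta>) \<bullet> y" for t y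
  define w where "w t y = far_coeff (3 * r) \<kappa> n (of_real (\<alpha> t y)) ((norm y)\<^sup>2)" for t y
  define w1 where "w1 t y = of_real (\<beta> t y) * far_coeff_a (3 * r) \<kappa> n (of_real (\<alpha> t y)) ((norm y)\<^sup>2)" for t y
  define w2 where "w2 t y = of_real ((\<beta> t y)\<^sup>2) * far_coeff_aa (3 * r) \<kappa> n (of_real (\<alpha> t y)) ((norm y)\<^sup>2)
      - of_real (\<alpha> t y) * far_coeff_a (3 * r) \<kappa> n (of_real (\<alpha> t y)) ((norm y)\<^sup>2)" for t y
  have unit: "norm (cos t *\<^sub>R \<theta> + sin t *\<^sub>R e) = 1" "norm (cos t *\<^sub>R e - sin t *\<^sub>R \<theta>) = 1" for t
    using assms(4-6)
    by (simp_all add: norm_eq_1 inner_left_distrib inner_right_distrib inner_diff_left inner_diff_right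
        inner_commute power2_eq_square[symmetric])
  have space: "space M = cball 0 r" by (simp add: M_def)
  have bound: "\<bar>\<alpha> t y\<bar> \<le> r" "\<bar>\<beta> t y\<bar> \<le> r" if "y \<in> space M" for t y
    using that Cauchy_Schwarz_ineq2[of "cos t *\<^sub>R \<theta> + sin t *\<^sub>R e" y]
      Cauchy_Schwarz_ineq2[of "cos t *\<^sub>R e - sin t *\<^sub>R \<theta>" y]
    by (auto simp: space \<alpha>_def \<beta>_def unit)
  obtain C where C:
    "\<And>a B. \<bar>a\<bar> \<le> 2 * r \<Longrightarrow> 0 \<le> B \<Longrightarrow> B \<le> r\<^sup>2 \<Longrightarrow> norm (far_coeff (3 * r) \<kappa> n (of_real a) B) \<le> C"
    "\<And>a B. \<bar>a\<bar> \<le> 2 * r \<Longrightarrow> 0 \<le> B \<Longrightarrow> B \<le> r\<^sup>2 \<Longrightarrow> norm (far_coeff_a (3 * r) \<kappa> n (of_real a) B) \<le> C"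
    "\<And>a B. \<bar>a\<bar> \<le> 2 * r \<Longrightarrow> 0 \<le> B \<Longrightarrow> B \<le> r\<^sup>2 \<Longrightarrow> norm (far_coeff_aa (3 * r) \<kappa> n (of_real a) B) \<le> C"
    using far_coeff_bounded[OF assms(1), where \<kappa> = \<kappa> and n = n] by blast
  have y: "(norm y)\<^sup>2 \<le> r\<^sup>2" "\<bar>\<alpha> t y\<bar> \<le> 2 * r" if "y \<in> space M" for t y
    using that bound(1)[OF that, of t] assms(1) by (auto simp: space intro!: power_mono)
  have wC: "norm (w t y) \<le> C" "norm (w1 t y) \<le> r * C" "norm (w2 t y) \<le> r\<^sup>2 * C + r * C"
    if "y \<in> space M" for t y
  proof -
    note Cy = C[OF y(2)[OF that, of t] zero_le_power2 y(1)[OF that]]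
    show "norm (w t y) \<le> C" unfolding w_def by (rule Cy)
    show "norm (w1 t y) \<le> r * C"
      unfolding w1_def norm_mult norm_of_real
      by (intro mult_mono bound[OF that] Cy) (use assms in auto)
    have "(\<beta> t y)\<^sup>2 \<le> r\<^sup>2"
      using power_mono[OF bound(2)[OF that, of t], of 2] by simp
    then show "norm (w2 t y) \<le> r\<^sup>2 * C + r * C"
      unfolding w2_def
      by (intro order_trans[OF norm_triangle_ineq4] add_mono; unfold norm_mult norm_of_real)
        (intro mult_mono Cy; use bound[OF that, of t] assms in auto)+
  qed
  have d\<alpha>: "((\<lambda>t. complex_of_real (\<alpha> t y)) has_vector_derivative of_real (\<beta> t y)) (at t)"
    "((\<lambda>t. complex_of_real (\<beta> t y)) has_vector_derivative of_real (- \<alpha> t y)) (at t)" for t y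
    by (rule has_vector_derivative_of_real,
        auto simp: \<alpha>_def \<beta>_def inner_left_distrib inner_diff_left intro!: derivative_eq_intros)+
  have dom: "norm (complex_of_real (\<alpha> t y)) < 3 * r" "0 \<le> (norm y)\<^sup>2" "(norm y)\<^sup>2 \<le> (3 * r)\<^sup>2" "0 < 3 * r"
    if "y \<in> space M" for t y
    using y(2)[OF that, of t] power_mono[of "norm y" "3 * r" 2] assms(1) that by (auto simp: space)
  note dF = far_coeff_derivatives[OF dom(4,1,2,3)]
  \<comment> \<open>\<open>\<alpha>'\<close> is \<open>\<beta>\<close> and \<open>\<beta>'\<close> is \<open>-\<alpha>\<close>, hence \<open>w1\<close> and \<open>w2\<close> are the derivatives of \<open>w\<close>.\<close>
  have dw: "((\<lambda>t. w t y) has_vector_derivative w1 t y) (at t)" if "y \<in> space M" for t y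
    using field_vector_diff_chain_at[OF d\<alpha>(1) dF(1)[OF that that that that]]
    by (simp add: w_def w1_def o_def)
  have dw1: "((\<lambda>t. w1 t y) has_vector_derivative w2 t y) (at t)" if "y \<in> space M" for t y
    using has_vector_derivative_mult[OF d\<alpha>(2)
        field_vector_diff_chain_at[OF d\<alpha>(1) dF(2)[OF that that that that]]]
    by (simp add: w2_def w1_def o_def power2_eq_square mult.assoc)
  have cont: "continuous_on UNIV (\<alpha> t)" for t
    unfolding \<alpha>_def by (intro continuous_intros)
  have w_meas: "w t \<in> borel_measurable M" for t
    unfolding w_def M_def
    by (rule measurable_far_coeff(1)[OF assms(1) cont]) (use y(2) space in auto)
  have w_zero: "(\<integral>y. w t y * f y \<partial>M) = 0" for t
    using zero[OF unit(1)[of t]] by (simp add: far_field_coeff_def w_def \<alpha>_def M_def)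
  define C' where "C' = max C (r * C)"
  define C'' where "C'' = max (r * C) (r\<^sup>2 * C + r * C)"
  have f: "integrable M f" using f by (simp add: M_def)
  have 1: "(\<integral>y. w1 t y * f y \<partial>M) = 0" "w1 t \<in> borel_measurable M" for t
    by (rule integral_derivative_vanishes[OF f w_meas _ dw, where C = C'];
        (use wC w_zero in \<open>auto simp: C'_def max.coboundedI1 max.coboundedI2\<close>))+
  have "(\<integral>y. w2 0 y * f y \<partial>M) = 0"
    by (rule integral_derivative_vanishes(1)[OF f 1(2) _ dw1, where C = C''];
        (use wC 1(1) in \<open>auto simp: C''_def max.coboundedI1 max.coboundedI2\<close>))
  then show ?thesis
    by (simp add: w2_def \<alpha>_def \<beta>_def M_def)
qed

text \<open>The unit vectors that complete \<open>\<theta>\<close> to an orthonormal basis; the sum is Parseval's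
  identity.\<close>

lemma orthonormal_companions:
  fixes \<theta> :: "real^3"
  assumes "norm \<theta> = 1"
  obtains S where "finite S" "card S = 2"
    and "\<And>e. e \<in> S \<Longrightarrow> norm e = 1" "\<And>e. e \<in> S \<Longrightarrow> \<theta> \<bullet> e = 0"
    and "\<And>y. (\<Sum>e\<in>S. (e \<bullet> y)\<^sup>2) = (norm y)\<^sup>2 - (\<theta> \<bullet> y)\<^sup>2"
proof -
  obtain T where T: "\<theta> \<in> T" "pairwise orthogonal T" "\<And>x. x \<in> T \<Longrightarrow> norm x = 1"
      "independent T" "card T = DIM(real^3)" "span T = UNIV"
    using vector_in_orthonormal_basis[OF assms] by blast
  have fin: "finite T" using T(5) by (intro card_ge_0_finite) simp
  have "(norm y)\<^sup>2 = (\<Sum>e\<in>T. (e \<bullet> y)\<^sup>2)" for y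
  proof -
    have "(\<Sum>e\<in>T. (y \<bullet> e) *\<^sub>R e) = y"
      using T fin by (intro orthonormal_basis_expand) auto
    then have "(norm y)\<^sup>2 = (\<Sum>e\<in>T. (y \<bullet> e) *\<^sub>R e) \<bullet> y"
      by (simp add: power2_norm_eq_inner)
    also have "\<dots> = (\<Sum>e\<in>T. (e \<bullet> y)\<^sup>2)"
      unfolding inner_sum_left by (simp add: power2_eq_square inner_commute)
    finally show ?thesis .
  qed
  then have "(\<Sum>e\<in>T - {\<theta>}. (e \<bullet> y)\<^sup>2) = (norm y)\<^sup>2 - (\<theta> \<bullet> y)\<^sup>2" for y
    using sum.remove[OF fin T(1), of "\<lambda>e. (e \<bullet> y)\<^sup>2"] by simp
  moreover have "\<theta> \<bullet> e = 0" if "e \<in> T - {\<theta>}" for e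
    using T(1,2) that by (auto simp: pairwise_def orthogonal_def)
  ultimately show thesis
    using T fin by (intro that[of "T - {\<theta>}"]) auto
qed

text \<open>The recursion expresses a coefficient through the Laplace--Beltrami operator of the sphere
  applied to the preceding one; this operator is the sum of the second derivatives along two
  orthogonal great circles.\<close>

lemma far_field_coeffs_vanish:
  assumes "0 < r" "0 < \<kappa>" and f: "integrable (lebesgue_on (cball 0 r)) f"
    and zero: "\<And>\<theta>. norm \<theta> = 1 \<Longrightarrow> far_field_coeff r \<kappa> f 0 \<theta> = 0"
    and "norm \<theta> = 1"
  shows "far_field_coeff r \<kappa> f n \<theta> = 0"
  using assms(5)
proof (induction n arbitrary: \<theta>)
  case 0
  then show ?case by (rule zero)
next
  case (Suc n)
  define M where "M = lebesgue_on (cball (0 :: real^3) r)"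
  have space: "space M = cball 0 r" by (simp add: M_def)
  obtain S where S: "finite S" "card S = 2" "\<And>e. e \<in> S \<Longrightarrow> norm e = 1" "\<And>e. e \<in> S \<Longrightarrow> \<theta> \<bullet> e = 0"
    "\<And>y. (\<Sum>e\<in>S. (e \<bullet> y)\<^sup>2) = (norm y)\<^sup>2 - (\<theta> \<bullet> y)\<^sup>2"
    using orthonormal_companions[OF Suc.prems] by blast
  define V where "V m y = far_coeff (3 * r) \<kappa> m (of_real (\<theta> \<bullet> y)) ((norm y)\<^sup>2)" for m y
  define V1 where "V1 y = far_coeff_a (3 * r) \<kappa> n (of_real (\<theta> \<bullet> y)) ((norm y)\<^sup>2)" for y
  define V2 where "V2 y = far_coeff_aa (3 * r) \<kappa> n (of_real (\<theta> \<bullet> y)) ((norm y)\<^sup>2)" for y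
  have dom: "\<bar>\<theta> \<bullet> y\<bar> \<le> r" "\<bar>\<theta> \<bullet> y\<bar> \<le> 2 * r" "(norm y)\<^sup>2 \<le> r\<^sup>2" "(norm y)\<^sup>2 \<le> (3 * r)\<^sup>2" if "y \<in> space M" for y
    using that Cauchy_Schwarz_ineq2[of \<theta> y] Suc.prems assms(1) power_mono[of "norm y" r 2]
      power_mono[of "norm y" "3 * r" 2] by (auto simp: space)
  have meas: "V m \<in> borel_measurable M" "V1 \<in> borel_measurable M" "V2 \<in> borel_measurable M" for m
    unfolding V_def V1_def V2_def M_def
    by (rule measurable_far_coeff[OF assms(1)]; use dom(2) space in \<open>auto intro!: continuous_intros\<close>)+
  obtain C where bound:
    "\<And>a B. \<bar>a\<bar> \<le> 2 * r \<Longrightarrow> 0 \<le> B \<Longrightarrow> B \<le> r\<^sup>2 \<Longrightarrow> norm (far_coeff (3 * r) \<kappa> n (of_real a) B) \<le> C"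
    "\<And>a B. \<bar>a\<bar> \<le> 2 * r \<Longrightarrow> 0 \<le> B \<Longrightarrow> B \<le> r\<^sup>2 \<Longrightarrow> norm (far_coeff_a (3 * r) \<kappa> n (of_real a) B) \<le> C"
    "\<And>a B. \<bar>a\<bar> \<le> 2 * r \<Longrightarrow> 0 \<le> B \<Longrightarrow> B \<le> r\<^sup>2 \<Longrightarrow> norm (far_coeff_aa (3 * r) \<kappa> n (of_real a) B) \<le> C"
    using far_coeff_bounded[OF assms(1), where \<kappa> = \<kappa> and n = n] by blast
  have C: "norm (V n y) \<le> C" "norm (V1 y) \<le> C" "norm (V2 y) \<le> C" if "y \<in> space M" for y
    unfolding V_def V1_def V2_def using that by (intro bound dom zero_le_power2; simp)+
  have f: "integrable M f" using f by (simp add: M_def)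
  have int_V: "integrable M (\<lambda>y. V n y * f y)"
    by (rule integrable_bounded_mult[OF f meas(1) C(1)])
  have e_meas: "(\<lambda>y. complex_of_real (g y)) \<in> borel_measurable M" if "continuous_on UNIV g" for g
    unfolding M_def using that continuous_on_subset
    by (intro continuous_imp_measurable_on_sets_lebesgue continuous_on_of_real) auto
  define D where "D e y = (of_real ((e \<bullet> y)\<^sup>2) * V2 y - of_real (\<theta> \<bullet> y) * V1 y) * f y" for e y
  have int_D: "integrable M (D e)" if "e \<in> S" for e
    unfolding D_def
  proof (rule integrable_bounded_mult[OF f])
    show "(\<lambda>y. of_real ((e \<bullet> y)\<^sup>2) * V2 y - of_real (\<theta> \<bullet> y) * V1 y) \<in> borel_measurable M"
      by (intro borel_measurable_diff borel_measurable_times meas e_meas continuous_intros)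
    fix y assume y: "y \<in> space M"
    have "\<bar>e \<bullet> y\<bar> \<le> r" using y Cauchy_Schwarz_ineq2[of e y] S(3)[OF that] by (simp add: space)
    then have "(e \<bullet> y)\<^sup>2 \<le> r\<^sup>2" using power_mono[of "\<bar>e \<bullet> y\<bar>" r 2] by simp
    then show "norm (of_real ((e \<bullet> y)\<^sup>2) * V2 y - of_real (\<theta> \<bullet> y) * V1 y) \<le> r\<^sup>2 * C + r * C"
      by (intro order_trans[OF norm_triangle_ineq4] add_mono; unfold norm_mult norm_of_real)
        (intro mult_mono C[OF y]; use dom(1)[OF y] assms(1) in auto)+
  qed
  have zero_D: "(\<integral>y. D e y \<partial>M) = 0" if "e \<in> S" for e
    unfolding D_def V1_def V2_def M_def
    by (rule great_circle_derivative_vanishes[OF assms(1) assms(3) Suc.IH Suc.prems S(3)[OF that] S(4)[OF that]])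
  have "2 * \<i> * \<kappa> * of_nat (n + 1) * (V (n + 1) y * f y)
      = of_nat (n * (n + 1)) * (V n y * f y) + (\<Sum>e\<in>S. D e y)" if "y \<in> space M" for y
  proof -
    have sum: "(\<Sum>e\<in>S. D e y) = (of_real (\<Sum>e\<in>S. (e \<bullet> y)\<^sup>2) * V2 y - 2 * of_real (\<theta> \<bullet> y) * V1 y) * f y"
      unfolding D_def sum_distrib_right[symmetric] sum_subtractf of_real_sum using S(2) by simp
    have rec: "2 * \<i> * \<kappa> * of_nat (n + 1) * V (n + 1) y = of_nat (n * (n + 1)) * V n y
        + ((of_real ((norm y)\<^sup>2) - (of_real (\<theta> \<bullet> y))\<^sup>2) * V2 y - 2 * of_real (\<theta> \<bullet> y) * V1 y)"
      unfolding V_def V1_def V2_def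
      using dom[OF that] assms(1) by (intro far_coeff_recursion) auto
    have "2 * \<i> * \<kappa> * of_nat (n + 1) * (V (n + 1) y * f y)
        = (2 * \<i> * \<kappa> * of_nat (n + 1) * V (n + 1) y) * f y"
      by (simp only: mult.assoc)
    also have "\<dots> = of_nat (n * (n + 1)) * (V n y * f y) + (\<Sum>e\<in>S. D e y)"
      unfolding rec sum S(5) by (simp add: algebra_simps)
    finally show ?thesis .
  qed
  then have "2 * \<i> * \<kappa> * of_nat (n + 1) * (\<integral>y. V (n + 1) y * f y \<partial>M)
      = (\<integral>y. of_nat (n * (n + 1)) * (V n y * f y) + (\<Sum>e\<in>S. D e y) \<partial>M)"
    unfolding integral_mult_right_zero[symmetric] by (intro Bochner_Integration.integral_cong) auto
  also have "\<dots> = of_nat (n * (n + 1)) * (\<integral>y. V n y * f y \<partial>M) + (\<Sum>e\<in>S. (\<integral>y. D e y \<partial>M))"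
    using int_V int_D by (subst Bochner_Integration.integral_add)
      (auto simp: Bochner_Integration.integral_sum)
  also have "\<dots> = 0"
    using Suc.IH[OF Suc.prems] zero_D by (simp add: far_field_coeff_def V_def M_def)
  finally have "(\<integral>y. V (n + 1) y * f y \<partial>M) = 0" using assms(2) by (simp del: of_nat_add of_nat_Suc)
  then show ?case by (simp add: far_field_coeff_def V_def M_def)
qed

lemma helmholtz_green_radial:
  assumes "norm \<theta> = 1" "norm y < t" "0 < t"
  shows "helmholtz_green \<kappa> (t *\<^sub>R \<theta>) y
    = exp (\<i> * of_real (\<kappa> * t)) / of_real (4 * pi * t) * wave \<kappa> 1 (of_real (\<theta> \<bullet> y)) ((norm y)\<^sup>2) (of_real (1 / t))"
proof -
  define d where "d = norm (t *\<^sub>R \<theta> - y)"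
  have "d \<ge> norm (t *\<^sub>R \<theta>) - norm y" unfolding d_def by (rule norm_triangle_ineq2)
  then have d: "d > 0" using assms by simp
  have d2: "d\<^sup>2 = t\<^sup>2 - 2 * t * (\<theta> \<bullet> y) + (norm y)\<^sup>2"
    using assms(1) unfolding d_def power2_norm_eq_inner
    by (simp add: inner_diff_left inner_diff_right inner_commute norm_eq_1 power2_eq_square)
  have "rel_sq (of_real (\<theta> \<bullet> y)) ((norm y)\<^sup>2) (of_real (1 / t)) = of_real (1 - 2 * (\<theta> \<bullet> y) * (1 / t) + (norm y)\<^sup>2 * (1 / t)\<^sup>2)"
    by (simp add: rel_sq_def)
  also have "1 - 2 * (\<theta> \<bullet> y) * (1 / t) + (norm y)\<^sup>2 * (1 / t)\<^sup>2 = (d / t)\<^sup>2"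
    using assms(3) unfolding power_divide d2 by (simp add: field_simps power2_eq_square)
  finally have q: "csqrt (rel_sq (of_real (\<theta> \<bullet> y)) ((norm y)\<^sup>2) (of_real (1 / t))) = of_real (d / t)"
    using d assms(3) by (simp add: csqrt_of_real_nonneg)
  have "(norm y)\<^sup>2 * (1 / t) - 2 * (\<theta> \<bullet> y) = (d - t) * (d + t) / t"
    using d2 assms(3) by (simp add: field_simps power2_eq_square)
  moreover have "1 + d / t = (d + t) / t" using assms(3) by (simp add: field_simps)
  ultimately have "((norm y)\<^sup>2 * (1 / t) - 2 * (\<theta> \<bullet> y)) / (1 + d / t) = d - t"
    using d assms(3) by simp
  then have ph: "(of_real ((norm y)\<^sup>2) * of_real (1 / t) - 2 * of_real (\<theta> \<bullet> y)) / (1 + of_real (d / t))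
      = complex_of_real (d - t)"
    by (metis (mono_tags, opaque_lifting) of_real_1 of_real_add of_real_diff of_real_divide of_real_mult of_real_numeral)
  have "exp (\<i> * of_real (\<kappa> * d)) = exp (\<i> * of_real (\<kappa> * t)) * exp (\<i> * \<kappa> * of_real (d - t))"
    by (simp add: exp_add[symmetric] algebra_simps)
  then show ?thesis
    unfolding helmholtz_green_def wave_def q ph d_def[symmetric]
    using d assms(3) by (simp add: field_simps)
qed

text \<open>The bound \<open>C r\<^sub>2\<^sup>n\<close> for the coefficients of the kernel is uniform in \<open>y\<close>, so that the series
  may be integrated term by term for \<open>t > r\<^sub>2\<close>.\<close>

lemma far_field_expansion:
  assumes "0 < r" "r < r2" and f: "integrable (lebesgue_on (cball 0 r)) f"
  obtains C where "0 \<le> C"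
    and "\<And>\<theta> n. norm \<theta> = 1 \<Longrightarrow> norm (far_field_coeff r \<kappa> f n \<theta>) \<le> C * r2 ^ n"
    and "\<And>\<theta> t. norm \<theta> = 1 \<Longrightarrow> r2 < t \<Longrightarrow>
      (\<lambda>n. far_field_coeff r \<kappa> f n \<theta> * of_real (1 / t) ^ n) sums
      (of_real (4 * pi * t) * exp (- \<i> * of_real (\<kappa> * t))
        * (LINT y|lebesgue_on (cball 0 r). helmholtz_green \<kappa> (t *\<^sub>R \<theta>) y * f y))"
proof -
  define M where "M = lebesgue_on (cball (0 :: real^3) r)"
  have space: "space M = cball 0 r" by (simp add: M_def)
  have f: "integrable M f" using f by (simp add: M_def)
  define N where "N = (\<integral>y. norm (f y) \<partial>M)"
  have N: "0 \<le> N" unfolding N_def by simp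
  have "r \<le> 3 * r" using assms(1) by simp
  obtain C where C: "0 \<le> C"
      "\<And>a B n. a\<^sup>2 \<le> B \<Longrightarrow> B \<le> r\<^sup>2 \<Longrightarrow> norm (far_coeff (3 * r) \<kappa> n (of_real a) B) \<le> C * r2 ^ n"
      "\<And>a B s. a\<^sup>2 \<le> B \<Longrightarrow> B \<le> r\<^sup>2 \<Longrightarrow> norm s < 1 / r \<Longrightarrow>
        (\<lambda>n. far_coeff (3 * r) \<kappa> n (of_real a) B * s ^ n) sums wave \<kappa> 1 (of_real a) B s"
    using far_coeff_sums[OF assms(1,2) \<open>r \<le> 3 * r\<close>, where \<kappa> = \<kappa>] by blast
  define V where "V \<theta> n y = far_coeff (3 * r) \<kappa> n (of_real (\<theta> \<bullet> y)) ((norm y)\<^sup>2)" for \<theta> n and y :: "real^3"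
  have dom: "(\<theta> \<bullet> y)\<^sup>2 \<le> (norm y)\<^sup>2" "(norm y)\<^sup>2 \<le> r\<^sup>2" "\<bar>\<theta> \<bullet> y\<bar> \<le> 2 * r"
    if "norm \<theta> = 1" "y \<in> space M" for \<theta> y
    using that Cauchy_Schwarz_ineq2[of \<theta> y] assms(1) power_mono[of "norm y" r 2]
      power_mono[of "\<bar>\<theta> \<bullet> y\<bar>" "norm y" 2] by (auto simp: space)
  have V: "norm (V \<theta> n y) \<le> C * r2 ^ n" if "norm \<theta> = 1" "y \<in> space M" for \<theta> n y
    unfolding V_def using C(2)[OF dom(1,2)[OF that]] .
  have meas: "V \<theta> n \<in> borel_measurable M" if "norm \<theta> = 1" for \<theta> n
    unfolding V_def M_def
    by (rule measurable_far_coeff[OF assms(1)])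
      (use dom(3)[OF that] space in \<open>auto intro!: continuous_intros\<close>)
  have coeff: "far_field_coeff r \<kappa> f n \<theta> = (\<integral>y. V \<theta> n y * f y \<partial>M)" for n \<theta>
    by (simp add: far_field_coeff_def V_def M_def)
  have int: "integrable M (\<lambda>y. V \<theta> n y * f y)" if "norm \<theta> = 1" for \<theta> n
    by (rule integrable_bounded_mult[OF f meas[OF that] V[OF that]])
  have norm_int: "(\<integral>y. norm (V \<theta> n y * f y) \<partial>M) \<le> C * r2 ^ n * N" if "norm \<theta> = 1" for \<theta> n
  proof -
    have "(\<integral>y. norm (V \<theta> n y * f y) \<partial>M) \<le> (\<integral>y. C * r2 ^ n * norm (f y) \<partial>M)"
    proof (rule integral_mono)
      show "integrable M (\<lambda>y. norm (V \<theta> n y * f y))" by (rule integrable_norm[OF int[OF that]])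
      show "integrable M (\<lambda>y. C * r2 ^ n * norm (f y))" using f by simp
      show "norm (V \<theta> n y * f y) \<le> C * r2 ^ n * norm (f y)" if "y \<in> space M" for y
        using V[OF \<open>norm \<theta> = 1\<close> that] by (simp add: norm_mult mult_right_mono)
    qed
    then show ?thesis by (simp add: N_def)
  qed
  show thesis
  proof (rule that)
    show "0 \<le> C * N" using C(1) N by simp
    fix \<theta> :: "real^3" assume \<theta>: "norm \<theta> = 1"
    show "norm (far_field_coeff r \<kappa> f n \<theta>) \<le> C * N * r2 ^ n" for n
      unfolding coeff using order_trans[OF integral_norm_bound norm_int[OF \<theta>]] by (simp add: mult_ac)
    fix t assume t: "r2 < t"
    have t0: "0 < t" "r < t" "0 < r2" using t assms by auto
    define s where "s = complex_of_real (1 / t)"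
    have s: "norm s = 1 / t" using t0 by (simp add: s_def norm_divide)
    have geo: "summable (\<lambda>n. (r2 / t) ^ n)" using t t0 by (intro summable_geometric) simp
    have "(\<lambda>n. \<integral>y. V \<theta> n y * f y * s ^ n \<partial>M) sums (\<integral>y. (\<Sum>n. V \<theta> n y * f y * s ^ n) \<partial>M)"
    proof (rule sums_integral)
      show "integrable M (\<lambda>y. V \<theta> n y * f y * s ^ n)" for n
        using int[OF \<theta>] by simp
      show "AE y in M. summable (\<lambda>n. norm (V \<theta> n y * f y * s ^ n))"
      proof (rule AE_I2, rule summable_comparison_test')
        show "summable (\<lambda>n. C * (r2 / t) ^ n * norm (f y))" for y
          using geo by (intro summable_mult summable_mult2)
        fix y n assume "y \<in> space M"
        then have "norm (V \<theta> n y) * norm (f y) * (1 / t) ^ n \<le> C * r2 ^ n * norm (f y) * (1 / t) ^ n"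
          using V[OF \<theta>] t0 by (intro mult_right_mono) auto
        then show "norm (norm (V \<theta> n y * f y * s ^ n)) \<le> C * (r2 / t) ^ n * norm (f y)"
          using t0 by (simp add: norm_mult norm_power s power_divide mult_ac power_abs[symmetric])
      qed
      show "summable (\<lambda>n. \<integral>y. norm (V \<theta> n y * f y * s ^ n) \<partial>M)"
      proof (rule summable_comparison_test')
        show "summable (\<lambda>n. C * (r2 / t) ^ n * N)"
          using geo by (intro summable_mult summable_mult2)
        show "norm (\<integral>y. norm (V \<theta> n y * f y * s ^ n) \<partial>M) \<le> C * (r2 / t) ^ n * N" for n
        proof -
          have "(\<integral>y. norm (V \<theta> n y * f y * s ^ n) \<partial>M) = (\<integral>y. norm (V \<theta> n y * f y) \<partial>M) * (1 / t) ^ n"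
            unfolding norm_mult[of _ "s ^ n"] norm_power s by simp
          moreover have "\<dots> \<le> C * r2 ^ n * N * (1 / t) ^ n"
            using norm_int[OF \<theta>] t0 by (intro mult_right_mono) auto
          ultimately show ?thesis using t0 by (simp add: power_divide mult_ac power_abs[symmetric])
        qed
      qed
    qed
    moreover have "(\<Sum>n. V \<theta> n y * f y * s ^ n)
        = of_real (4 * pi * t) * exp (- \<i> * of_real (\<kappa> * t)) * (helmholtz_green \<kappa> (t *\<^sub>R \<theta>) y * f y)"
      if "y \<in> space M" for y
    proof -
      have "norm s < 1 / r" using s t0 assms(1) by (simp add: divide_strict_left_mono)
      then have "(\<lambda>n. V \<theta> n y * s ^ n * f y) sums (wave \<kappa> 1 (of_real (\<theta> \<bullet> y)) ((norm y)\<^sup>2) s * f y)"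
        unfolding V_def by (intro sums_mult2 C(3) dom[OF \<theta> that])
      then have "(\<Sum>n. V \<theta> n y * f y * s ^ n) = wave \<kappa> 1 (of_real (\<theta> \<bullet> y)) ((norm y)\<^sup>2) s * f y"
        by (simp add: sums_iff mult_ac)
      moreover have "norm y < t" using that t0 by (simp add: space)
      ultimately show ?thesis
        using t0 unfolding helmholtz_green_radial[OF \<theta> \<open>norm y < t\<close> t0(1)] s_def[symmetric]
        by (simp add: exp_minus)
    qed
    ultimately have "(\<lambda>n. \<integral>y. V \<theta> n y * f y * s ^ n \<partial>M) sums
        (\<integral>y. of_real (4 * pi * t) * exp (- \<i> * of_real (\<kappa> * t)) * (helmholtz_green \<kappa> (t *\<^sub>R \<theta>) y * f y) \<partial>M)"
      by (simp cong: Bochner_Integration.integral_cong)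
    then show "(\<lambda>n. far_field_coeff r \<kappa> f n \<theta> * of_real (1 / t) ^ n) sums
      (of_real (4 * pi * t) * exp (- \<i> * of_real (\<kappa> * t))
        * (LINT y|lebesgue_on (cball 0 r). helmholtz_green \<kappa> (t *\<^sub>R \<theta>) y * f y))"
      unfolding coeff M_def[symmetric] s_def[symmetric] integral_mult_right_zero integral_mult_left_zero .
  qed
qed

text \<open>The function \<open>F\<close> is the leading coefficient of the expansion, and the remaining terms are
  dominated by a geometric series; if \<open>F\<close> vanishes on the sphere, all coefficients do.\<close>

lemma potential_far_field:
  assumes "0 < r" "r < R" "0 < \<kappa>" and f: "integrable (lebesgue_on (cball 0 r)) f"
  obtains F C where
    "\<And>x. R \<le> norm x \<Longrightarrow> norm (of_real (norm x) * exp (- \<i> * of_real (\<kappa> * norm x))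
        * (LINT y|lebesgue_on (cball 0 r). helmholtz_green \<kappa> x y * f y) - F (x /\<^sub>R norm x)) \<le> C / norm x"
    and "\<And>x. (\<And>\<theta>. norm \<theta> = 1 \<Longrightarrow> F \<theta> = 0) \<Longrightarrow> R \<le> norm x \<Longrightarrow>
      (LINT y|lebesgue_on (cball 0 r). helmholtz_green \<kappa> x y * f y) = 0"
proof -
  define c where "c = far_field_coeff r \<kappa> f"
  define u where "u x = (LINT y|lebesgue_on (cball 0 r). helmholtz_green \<kappa> x y * f y)" for x
  define r2 where "r2 = (r + R) / 2"
  have r2: "0 < r2" "r < r2" "r2 < R" using assms by (auto simp: r2_def)
  obtain C where C: "0 \<le> C" "\<And>\<theta> n. norm \<theta> = 1 \<Longrightarrow> norm (c n \<theta>) \<le> C * r2 ^ n"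
    "\<And>\<theta> t. norm \<theta> = 1 \<Longrightarrow> r2 < t \<Longrightarrow> (\<lambda>n. c n \<theta> * of_real (1 / t) ^ n) sums
      (of_real (4 * pi * t) * exp (- \<i> * of_real (\<kappa> * t)) * u (t *\<^sub>R \<theta>))"
    using far_field_expansion[OF assms(1) r2(2) f, where \<kappa> = \<kappa>] unfolding c_def u_def by blast
  have polar: "norm (x /\<^sub>R norm x) = 1" "norm x *\<^sub>R (x /\<^sub>R norm x) = x" "r2 < norm x" "0 < norm x"
    if "R \<le> norm x" for x :: "real^3"
  proof -
    show n: "0 < norm x" "r2 < norm x" using that assms r2 by auto
    then show "norm (x /\<^sub>R norm x) = 1" "norm x *\<^sub>R (x /\<^sub>R norm x) = x" by auto
  qed
  have sums: "(\<lambda>n. c n (x /\<^sub>R norm x) * of_real (1 / norm x) ^ n) sums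
      (of_real (4 * pi * norm x) * exp (- \<i> * of_real (\<kappa> * norm x)) * u x)" if "R \<le> norm x" for x
    using C(3)[OF polar(1,3)[OF that]] unfolding polar(2)[OF that] .
  \<comment> \<open>The sum over \<open>n \<ge> 1\<close> of \<open>C q\<^sup>n\<close> with \<open>q = r2/|x| \<le> r2/R\<close> is at most \<open>4\<pi> K/|x|\<close>.\<close>
  define K where "K = C * r2 / (1 - r2 / R) / (4 * pi)"
  show thesis
  proof (rule that)
    fix x :: "real^3" assume x: "R \<le> norm x"
    define \<theta> where "\<theta> = x /\<^sub>R norm x"
    define q where "q = r2 / norm x"
    have q: "0 \<le> q" "q < 1" "q \<le> r2 / R"
      using r2 x assms polar[OF x] by (auto simp: q_def divide_left_mono)
    have tail: "(\<lambda>n. c (Suc n) \<theta> * of_real (1 / norm x) ^ Suc n) sums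
        (of_real (4 * pi * norm x) * exp (- \<i> * of_real (\<kappa> * norm x)) * u x - c 0 \<theta>)"
      using sums[OF x] unfolding \<theta>_def[symmetric] by (subst sums_Suc_iff) simp
    have bound: "norm (c (Suc n) \<theta> * of_real (1 / norm x) ^ Suc n) \<le> C * q * q ^ n" for n
    proof -
      have "norm (c (Suc n) \<theta> * of_real (1 / norm x) ^ Suc n) = norm (c (Suc n) \<theta>) * (1 / norm x) ^ Suc n"
        by (simp add: norm_mult norm_power norm_divide)
      also have "\<dots> \<le> C * r2 ^ Suc n * (1 / norm x) ^ Suc n"
        using C(2)[OF polar(1)[OF x], of "Suc n"] unfolding \<theta>_def
        by (intro mult_right_mono) auto
      also have "\<dots> = C * q * q ^ n" by (simp add: q_def power_divide)
      finally show ?thesis .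
    qed
    have geo: "(\<lambda>n. C * q * q ^ n) sums (C * q * (1 / (1 - q)))"
      using q by (intro sums_mult geometric_sums) simp
    have "norm (of_real (4 * pi * norm x) * exp (- \<i> * of_real (\<kappa> * norm x)) * u x - c 0 \<theta>)
        \<le> (\<Sum>n. C * q * q ^ n)"
      unfolding sums_unique[OF tail]
      by (rule norm_suminf_le[OF bound sums_summable[OF geo]])
    also have "\<dots> = C * q * (1 / (1 - q))" using sums_unique[OF geo] by simp
    also have "\<dots> \<le> C * q * (1 / (1 - r2 / R))"
      using q C(1) r2 assms by (intro mult_left_mono divide_left_mono) auto
    also have "\<dots> = 4 * pi * (K / norm x)" by (simp add: K_def q_def)
    finally have "norm (of_real (4 * pi * norm x) * exp (- \<i> * of_real (\<kappa> * norm x)) * u x - c 0 \<theta>)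
        \<le> 4 * pi * (K / norm x)" .
    moreover have "of_real (4 * pi * norm x) * exp (- \<i> * of_real (\<kappa> * norm x)) * u x - c 0 \<theta>
        = of_real (4 * pi) * (of_real (norm x) * exp (- \<i> * of_real (\<kappa> * norm x)) * u x - c 0 \<theta> / of_real (4 * pi))"
      by (simp add: field_simps)
    ultimately have "4 * pi * norm (of_real (norm x) * exp (- \<i> * of_real (\<kappa> * norm x)) * u x - c 0 \<theta> / of_real (4 * pi))
        \<le> 4 * pi * (K / norm x)"
      by (simp add: norm_mult)
    then show "norm (of_real (norm x) * exp (- \<i> * of_real (\<kappa> * norm x))
        * (LINT y|lebesgue_on (cball 0 r). helmholtz_green \<kappa> x y * f y)
        - c 0 (x /\<^sub>R norm x) / of_real (4 * pi)) \<le> K / norm x"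
      unfolding u_def[symmetric] \<theta>_def[symmetric] by (rule mult_left_le_imp_le) simp
  next
    fix x :: "real^3"
    assume "\<And>\<theta>. norm \<theta> = 1 \<Longrightarrow> c 0 \<theta> / of_real (4 * pi) = 0" and x: "R \<le> norm x"
    then have "c 0 \<theta> = 0" if "norm \<theta> = 1" for \<theta> using that by simp
    then have "c n (x /\<^sub>R norm x) = 0" for n
      using far_field_coeffs_vanish[OF assms(1,3) f] polar(1)[OF x] unfolding c_def by blast
    then have "of_real (4 * pi * norm x) * exp (- \<i> * of_real (\<kappa> * norm x)) * u x = 0"
      using sums[OF x] by (simp add: sums_iff)
    then show "(LINT y|lebesgue_on (cball 0 r). helmholtz_green \<kappa> x y * f y) = 0"
      using polar(4)[OF x] by (simp add: u_def)
  qed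
qed

section \<open>The Green's function as a function of the squared distance\<close>

definition green_profile :: "real \<Rightarrow> complex \<Rightarrow> complex" where
  "green_profile \<kappa> t = exp (\<i> * \<kappa> * csqrt t) / (4 * pi * csqrt t)"

text \<open>Complex derivatives of the profile provide derivatives of all orders without formulas for
  them.\<close>

definition green_deriv :: "real \<Rightarrow> nat \<Rightarrow> real \<Rightarrow> complex" where
  "green_deriv \<kappa> n t = (deriv ^^ n) (green_profile \<kappa>) (of_real t)"

lemma green_deriv_has_derivative:
  assumes "0 < t"
  shows "(green_deriv \<kappa> n has_vector_derivative green_deriv \<kappa> (Suc n) t) (at t)"
proof -
  have "green_profile \<kappa> holomorphic_on - \<real>\<^sub>\<le>\<^sub>0"
    unfolding green_profile_def[abs_def] by (intro holomorphic_intros) auto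
  moreover have "open (- (\<real>\<^sub>\<le>\<^sub>0 :: complex set))" by (simp add: open_Compl)
  moreover have t: "complex_of_real t \<in> - \<real>\<^sub>\<le>\<^sub>0" using assms by (simp add: complex_nonpos_Reals_iff)
  ultimately have "((deriv ^^ n) (green_profile \<kappa>) has_field_derivative
      (deriv ^^ Suc n) (green_profile \<kappa>) (of_real t)) (at (of_real t))"
    using holomorphic_derivI[OF holomorphic_higher_deriv] by simp
  from field_vector_diff_chain_at[OF of_real_has_vector_derivative this]
  show ?thesis by (simp add: green_deriv_def[abs_def] o_def)
qed

lemma green_deriv_continuous_on:
  assumes "continuous_on S h" "\<And>x. x \<in> S \<Longrightarrow> 0 < h x"
  shows "continuous_on S (\<lambda>x. green_deriv \<kappa> n (h x))"
proof -
  have "isCont (green_deriv \<kappa> n) t" if "0 < t" for t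
    using green_deriv_has_derivative[OF that] has_vector_derivative_continuous by blast
  then have "continuous_on {0<..} (green_deriv \<kappa> n)"
    by (intro continuous_at_imp_continuous_on) auto
  then show ?thesis by (rule continuous_on_compose2) (use assms in auto)
qed

text \<open>This includes \<open>x = y\<close>, where both sides are \<open>0\<close> by division by zero.\<close>

lemma helmholtz_green_profile: "helmholtz_green \<kappa> x y = green_deriv \<kappa> 0 ((norm (x - y))\<^sup>2)"
  by (simp add: helmholtz_green_def green_deriv_def green_profile_def mult_ac)

lemma helmholtz_green_sym: "helmholtz_green \<kappa> x y = helmholtz_green \<kappa> y x"
  by (simp add: helmholtz_green_def norm_minus_commute)

lemma partial_norm_diff_square:
  "partial i (\<lambda>z::real^3. (norm (z - p))\<^sup>2) z = 2 * (z - p) $ i"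
proof -
  have "((\<lambda>z. (z - p) \<bullet> (z - p)) has_derivative (\<lambda>u. (z - p) \<bullet> u + u \<bullet> (z - p))) (at z)"
    by (auto intro!: derivative_eq_intros)
  from partial_has_derivative[OF this, of i] show ?thesis
    unfolding power2_norm_eq_inner by (simp add: inner_axis inner_axis')
qed

text \<open>The explicit form shows that the Hessian is symmetric and the same in both arguments of
  the Green's function.\<close>

lemma helmholtz_green_hessian:
  assumes "z \<noteq> p"
  shows "partial j (partial i (\<lambda>z. helmholtz_green \<kappa> z p)) z
    = green_deriv \<kappa> 2 ((norm (z - p))\<^sup>2) * of_real (4 * (z - p) $ i * (z - p) $ j)
      + green_deriv \<kappa> 1 ((norm (z - p))\<^sup>2) * of_real (2 * axis j 1 $ i)"
proof -
  define h where "h z = (norm (z - p))\<^sup>2" for z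
  have dh: "h differentiable at z" for z
    unfolding h_def using smooth_norm_diff_square by (rule smooth_differentiable)
  have pos: "0 < h z" if "z \<noteq> p" for z using that by (simp add: h_def)
  have ph: "partial i h z = 2 * (z - p) $ i" for i z
    unfolding h_def[abs_def] by (rule partial_norm_diff_square)
  have comp: "(\<lambda>z. green_deriv \<kappa> n (h z)) differentiable at z"
    "partial i (\<lambda>z. green_deriv \<kappa> n (h z)) z = green_deriv \<kappa> (Suc n) (h z) * of_real (2 * (z - p) $ i)"
    if "z \<noteq> p" for z n i
    using partial_compose[OF green_deriv_has_derivative[OF pos[OF that]] dh] by (simp_all add: ph)
  have "partial i (\<lambda>z. helmholtz_green \<kappa> z p) z = green_deriv \<kappa> 1 (h z) * of_real (2 * (z - p) $ i)"
    if "z \<noteq> p" for z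
    using comp(2)[OF that, of i 0] by (simp add: helmholtz_green_profile h_def)
  then have "partial j (partial i (\<lambda>z. helmholtz_green \<kappa> z p)) z
      = partial j (\<lambda>z. green_deriv \<kappa> 1 (h z) * of_real (2 * (z - p) $ i)) z"
    using assms by (intro partial_cong_open[of "- {p}"]) auto
  also have "\<dots> = green_deriv \<kappa> 1 (h z) * of_real (2 * axis j 1 $ i)
      + green_deriv \<kappa> 2 (h z) * of_real (2 * (z - p) $ j) * of_real (2 * (z - p) $ i)"
  proof -
    have lin: "((\<lambda>z. complex_of_real (2 * (z - p) $ i)) has_derivative (\<lambda>u. of_real (2 * u $ i))) (at z)"
      by (auto intro!: derivative_eq_intros bounded_linear.has_derivative[OF bounded_linear_of_real]
          bounded_linear.has_derivative[OF bounded_linear_vec_nth])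
    then have "(\<lambda>z. complex_of_real (2 * (z - p) $ i)) differentiable at z"
      unfolding differentiable_def by blast
    then show ?thesis
      using differentiable_and_partial_mult(2)[OF comp(1)[OF assms]] comp(2)[OF assms]
        partial_has_derivative[OF lin] by (simp add: numeral_2_eq_2)
  qed
  finally show ?thesis by (simp add: h_def algebra_simps)
qed

section \<open>The electric field as a Helmholtz potential\<close>

lemma cutoff_green_test_function:
  assumes \<eta>: "smooth \<eta>" "\<And>y. b \<le> norm y \<Longrightarrow> \<eta> y = 0" and "b < R" "R \<le> norm x"
  shows "(\<lambda>y. of_real (\<eta> y) * helmholtz_green \<kappa> x y) \<in> test_functions (ball 0 R)"
proof -
  define \<delta> where "\<delta> = (R - b)\<^sup>2"
  \<comment> \<open>The added term keeps the argument of the profile positive at \<open>y = x\<close>, and it vanishes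
    where \<open>\<eta> y \<noteq> 0\<close>, since there \<open>|y - x| \<ge> R - b\<close>.\<close>
  define h where "h y = (norm (y - x))\<^sup>2 + flat_exp 1 (\<delta> + (- 1) * (norm (y - x))\<^sup>2)" for y
  have h: "smooth h"
    unfolding h_def by (intro smooth_add smooth_mult smooth_flat_exp smooth_const smooth_norm_diff_square)
  have pos: "0 < h y" for y
    using assms(3) by (cases "(norm (y - x))\<^sup>2 < \<delta>")
      (auto simp: h_def flat_exp_def \<delta>_def add_nonneg_pos intro: less_le_trans)
  have "smooth (\<lambda>y. green_deriv \<kappa> 0 (h y))"
    using green_deriv_has_derivative[OF pos] h by (rule smooth_compose)
  then have "smooth (\<lambda>y. of_real (\<eta> y) * green_deriv \<kappa> 0 (h y))"
    by (rule smooth_mult[OF smooth_of_real[OF \<eta>(1)]])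
  moreover have "of_real (\<eta> y) * helmholtz_green \<kappa> x y = of_real (\<eta> y) * green_deriv \<kappa> 0 (h y)" for y
  proof (cases "norm y < b")
    case True
    have "R - b \<le> norm (y - x)"
      using True assms(4) norm_triangle_ineq2[of x y] by (simp add: norm_minus_commute)
    then have "\<delta> \<le> (norm (y - x))\<^sup>2"
      unfolding \<delta>_def using assms(3) by (intro power_mono) auto
    then show ?thesis
      by (simp add: helmholtz_green_profile h_def flat_exp_def norm_minus_commute)
  qed (simp add: \<eta>(2))
  ultimately have "smooth (\<lambda>y. of_real (\<eta> y) * helmholtz_green \<kappa> x y)"
    by (simp only:)
  moreover have "closure {y. of_real (\<eta> y) * helmholtz_green \<kappa> x y \<noteq> 0} \<subseteq> cball 0 b"
    using \<eta>(2) by (intro closure_minimal) (auto, meson not_le_imp_less less_le_not_le)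
  moreover have "compact (closure A)" if "closure A \<subseteq> cball 0 b" for A :: "(real^3) set"
    using that bounded_subset[OF bounded_cball] by (simp add: compact_eq_bounded_closed)
  ultimately show ?thesis
    using assms(3) by (auto simp: test_functions_def)
qed

text \<open>The complement of the support is a union of possibly uncountably many open sets on which
  \<open>J\<close> vanishes almost everywhere; by the theorem of Lindeloef countably many suffice.\<close>

lemma AE_zero_outside_ess_support: "AE y in lebesgue. y \<notin> ess_support J \<longrightarrow> J y = 0"
proof -
  define \<F> where "\<F> = {U. open U \<and> (AE y in lebesgue. y \<in> U \<longrightarrow> J y = 0)}"
  obtain \<F>' where F: "\<F>' \<subseteq> \<F>" "countable \<F>'" "\<Union>\<F>' = \<Union>\<F>"
    using Lindelof[of \<F>] by (auto simp: \<F>_def)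
  have "AE y in lebesgue. \<forall>U\<in>\<F>'. y \<in> U \<longrightarrow> J y = 0"
    using F(1,2) by (subst AE_ball_countable) (auto simp: \<F>_def)
  then show ?thesis
    by eventually_elim (use F(3) in \<open>auto simp: ess_support_def \<F>_def[symmetric]\<close>)
qed

lemma L2_fields_component:
  fixes \<Psi> :: "real^3 \<Rightarrow> complex^3"
  assumes "\<Psi> \<in> L2_fields (ball 0 R)"
  shows "integrable (lebesgue_on (ball 0 R)) (\<lambda>y. \<Psi> y $ i)"
proof -
  have meas: "\<Psi> \<in> borel_measurable (lebesgue_on (ball 0 R))"
    and sq: "integrable (lebesgue_on (ball 0 R)) (\<lambda>y. (norm (\<Psi> y))\<^sup>2)"
    using assms by (auto simp: L2_fields_def)
  interpret finite_measure "lebesgue_on (ball (0::real^3) R)"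
    by (rule finite_measure_lebesgue_on) simp
  show ?thesis
  proof (rule Bochner_Integration.integrable_bound)
    show "integrable (lebesgue_on (ball 0 R)) (\<lambda>y. 1 + (norm (\<Psi> y))\<^sup>2)"
      using sq by simp
    show "(\<lambda>y. \<Psi> y $ i) \<in> borel_measurable (lebesgue_on (ball 0 R))"
      by (rule borel_measurable_continuous_on[OF _ meas]) (intro continuous_intros)
    have "norm (\<Psi> y $ i) \<le> 1 + (norm (\<Psi> y))\<^sup>2" for y
    proof -
      have "0 \<le> (norm (\<Psi> y) - 1)\<^sup>2" by simp
      then have "2 * norm (\<Psi> y) \<le> 1 + (norm (\<Psi> y))\<^sup>2" by (simp add: power2_eq_square algebra_simps)
      moreover have "norm (\<Psi> y $ i) \<le> norm (\<Psi> y)" by (rule Finite_Cartesian_Product.norm_nth_le)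
      ultimately show ?thesis using norm_ge_zero[of "\<Psi> y"] by linarith
    qed
    then show "AE y in lebesgue_on (ball 0 R). norm (\<Psi> y $ i) \<le> norm (1 + (norm (\<Psi> y))\<^sup>2)"
      by (auto intro: order_trans[OF _ abs_ge_self])
  qed
qed

lemma integral_component:
  fixes H :: "'a \<Rightarrow> complex^3"
  assumes "\<And>i. integrable M (\<lambda>y. H y $ i)"
  shows "(\<integral>y. H y \<partial>M) $ i = (\<integral>y. H y $ i \<partial>M)"
proof -
  have lin: "bounded_linear (axis i :: complex \<Rightarrow> complex^3)" for i
    by (simp add: linear_conv_bounded_linear[symmetric] linear_iff vec_eq_iff axis_def)
  have H: "H = (\<lambda>y. \<Sum>i\<in>UNIV. axis i (H y $ i))"
    by (rule ext) (simp add: vec_eq_iff axis_def)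
  have "integrable M (\<lambda>y. \<Sum>i\<in>UNIV. axis i (H y $ i))"
    by (intro Bochner_Integration.integrable_sum integrable_bounded_linear[OF lin] assms)
  then have "integrable M H" by (subst H)
  then show ?thesis
    using integral_bounded_linear[OF bounded_linear_vec_nth, of M H i] by simp
qed

lemma integral_ball_cball:
  fixes F :: "real^3 \<Rightarrow> complex"
  assumes "r < R" and "\<And>y. r < norm y \<Longrightarrow> F y = 0"
  shows "(LINT y|lebesgue_on (ball 0 R). F y) = (LINT y|lebesgue_on (cball 0 r). F y)"
    and "integrable (lebesgue_on (ball 0 R)) F \<Longrightarrow> integrable (lebesgue_on (cball 0 r)) F"
proof -
  have "indicator (ball 0 R) y *\<^sub>R F y = indicator (cball 0 r) y *\<^sub>R F y" for y
    using assms by (cases "norm y \<le> r") (auto simp: indicator_def)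
  then have "(\<lambda>y. indicator (ball 0 R) y *\<^sub>R F y) = (\<lambda>y. indicator (cball 0 r) y *\<^sub>R F y)"
    by (rule ext)
  then show "(LINT y|lebesgue_on (ball 0 R). F y) = (LINT y|lebesgue_on (cball 0 r). F y)"
    "integrable (lebesgue_on (ball 0 R)) F \<Longrightarrow> integrable (lebesgue_on (cball 0 r)) F"
    by (simp_all add: integral_restrict_space integrable_restrict_space)
qed

lemma compact_subset_ball_smaller:
  fixes K :: "'a::real_normed_vector set"
  assumes "compact K" "K \<subseteq> ball 0 R" "0 < R"
  obtains a where "0 < a" "a < R" "K \<subseteq> ball 0 a"
proof (cases "K = {}")
  case True
  then show thesis using assms(3) by (intro that[of "R / 2"]) auto
next
  case False
  then obtain k where k: "k \<in> K" "\<And>y. y \<in> K \<Longrightarrow> norm y \<le> norm k"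
    using continuous_attains_sup[OF assms(1) False, of norm] continuous_on_norm_id by blast
  then have "norm k < R" using assms(2) by auto
  moreover from this have "norm y < (norm k + R) / 2" if "y \<in> K" for y
    using k(2)[OF that] by simp
  ultimately show thesis
    using assms(3) by (intro that[of "(norm k + R) / 2"]) (auto intro: add_nonneg_pos)
qed

text \<open>This is where \<open>\<nabla>(\<nabla> \<cdot> J) \<in> L\<^sup>2\<close> enters: a cut-off of the Green's function is a
  test function, and moving the two derivatives from the kernel to the source turns the dyadic kernel
  into a scalar one, acting on \<open>J + \<kappa>\<^sup>-\<^sup>2 \<nabla>(\<nabla> \<cdot> J)\<close>.\<close>

lemma electric_field_potential:
  fixes J :: "real^3 \<Rightarrow> complex^3"
  assumes "0 < R" and J: "J \<in> H_div_grad (ball 0 R)"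
    and K: "compact (ess_support J)" "ess_support J \<subseteq> ball 0 R"
  obtains r f where "0 < r" "r < R" "\<And>i. integrable (lebesgue_on (cball 0 r)) (f i)"
    and "\<And>x i. R \<le> norm x \<Longrightarrow> electric_field \<kappa> R J x $ i
      = (LINT y|lebesgue_on (cball 0 r). helmholtz_green \<kappa> x y * f i y)"
proof -
  define M where "M = lebesgue_on (ball (0 :: real^3) R)"
  have space: "space M = ball 0 R" by (simp add: M_def)
  obtain W where W: "W \<in> L2_fields (ball 0 R)"
    "\<And>i \<phi>. \<phi> \<in> test_functions (ball 0 R) \<Longrightarrow>
      dist_partial i (dist_div (ball 0 R) J) \<phi> = dist_of (ball 0 R) (\<lambda>x. W x $ i) \<phi>"
    and JL2: "J \<in> L2_fields (ball 0 R)"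
    using J unfolding H_div_grad_def by blast
  have int_J: "integrable M (\<lambda>y. J y $ i)" and int_W: "integrable M (\<lambda>y. W y $ i)" for i
    unfolding M_def by (rule L2_fields_component[OF JL2], rule L2_fields_component[OF W(1)])
  obtain a where a: "0 < a" "a < R" "ess_support J \<subseteq> ball 0 a"
    by (rule compact_subset_ball_smaller[OF K assms(1)])
  define r where "r = (a + R) / 2"
  have r: "0 < r" "a < r" "r < R" using a by (auto simp: r_def)
  obtain \<eta> :: "real^3 \<Rightarrow> real" where \<eta>: "smooth \<eta>" "\<And>y. norm y \<le> a \<Longrightarrow> \<eta> y = 1" "\<And>y. r \<le> norm y \<Longrightarrow> \<eta> y = 0"
    using smooth_cutoff[of a r] a r by auto
  define k where "k = complex_of_real (1 / \<kappa>\<^sup>2)"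
  define f where "f i y = of_real (\<eta> y) * (J y $ i + k * W y $ i)" for i y
  have cont_bdd: "\<phi> \<in> borel_measurable M" "\<exists>C. \<forall>y\<in>space M. norm (\<phi> y) \<le> C"
    if "smooth \<phi>" for \<phi> :: "real^3 \<Rightarrow> complex"
  proof -
    show "\<phi> \<in> borel_measurable M"
      unfolding M_def using smooth_continuous_on[OF that]
      by (intro continuous_imp_measurable_on_sets_lebesgue) auto
    have "bounded (\<phi> ` cball 0 R)"
      using smooth_continuous_on[OF that] by (intro compact_imp_bounded compact_continuous_image) auto
    then obtain C where "\<And>y. y \<in> cball 0 R \<Longrightarrow> norm (\<phi> y) \<le> C" unfolding bounded_iff by blast
    then show "\<exists>C. \<forall>y\<in>space M. norm (\<phi> y) \<le> C" unfolding space using ball_subset_cball by blast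
  qed
  have int_smooth: "integrable M (\<lambda>y. \<phi> y * g y)" if \<phi>: "smooth \<phi>" and g: "integrable M g" for \<phi> g :: "real^3 \<Rightarrow> complex"
  proof -
    obtain C where "\<And>y. y \<in> space M \<Longrightarrow> norm (\<phi> y) \<le> C" using cont_bdd(2)[OF \<phi>] by blast
    then show ?thesis by (rule integrable_bounded_mult[OF g cont_bdd(1)[OF \<phi>]])
  qed
  have int_f: "integrable M (f i)" for i
    unfolding f_def using int_J int_W smooth_of_real[OF \<eta>(1)] by (intro int_smooth) auto
  have f_zero: "f i y = 0" if "r < norm y" for i y using \<eta>(3)[of y] that by (simp add: f_def)
  have AE_J: "AE y in M. J y = 0 \<or> norm y < a"
    using AE_zero_outside_ess_support[of J] unfolding M_def
    by (subst AE_restrict_space_iff) (use a(3) in \<open>auto elim!: eventually_mono\<close>)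
  have field: "electric_field \<kappa> R J x $ i = (\<integral>y. helmholtz_green \<kappa> x y * f i y \<partial>M)"
    if x: "R \<le> norm x" for x i
  proof -
    define \<phi> where "\<phi> y = of_real (\<eta> y) * helmholtz_green \<kappa> x y" for y
    have \<phi>: "\<phi> \<in> test_functions (ball 0 R)"
      unfolding \<phi>_def using \<eta>(1,3) r x by (intro cutoff_green_test_function) auto
    then have smooth: "smooth \<phi>" by (simp add: test_functions_def)
    define G where "G i y = \<phi> y * J y $ i + k * (\<Sum>j\<in>UNIV. partial j (partial i \<phi>) y * J y $ j)" for i y
    have ne: "x \<noteq> y" if "y \<in> ball 0 R" for y using that x by auto
    have hess: "partial i (partial j (\<lambda>z. helmholtz_green \<kappa> z y)) x
        = green_deriv \<kappa> 2 ((norm (x - y))\<^sup>2) * of_real (4 * (x - y) $ j * (x - y) $ i)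
          + green_deriv \<kappa> 1 ((norm (x - y))\<^sup>2) * of_real (2 * axis i 1 $ j)"
      if "y \<in> ball 0 R" for y i j
      by (rule helmholtz_green_hessian[OF ne[OF that]])
    have hess': "partial j (partial i \<phi>) y = partial i (partial j (\<lambda>z. helmholtz_green \<kappa> z y)) x"
      if "norm y < a" for y i j
    proof -
      have y: "y \<in> ball 0 R" using that a by simp
      have open_a: "open (ball (0 :: real^3) a)" by simp
      have eq: "partial i \<phi> z = partial i (\<lambda>z. helmholtz_green \<kappa> z x) z" if "z \<in> ball 0 a" for z
        by (rule partial_cong_open[OF open_a that]) (simp add: \<phi>_def \<eta>(2) helmholtz_green_sym)
      have "partial j (partial i \<phi>) y = partial j (partial i (\<lambda>z. helmholtz_green \<kappa> z x)) y"
        by (rule partial_cong_open[OF open_a _ eq]) (use that in auto)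
      also have "\<dots> = partial i (partial j (\<lambda>z. helmholtz_green \<kappa> z y)) x"
        using ne[OF y] unfolding hess[OF y] by (subst helmholtz_green_hessian)
          (auto simp: norm_minus_commute axis_def algebra_simps)
      finally show ?thesis .
    qed
    have comp: "(maxwell_green \<kappa> x y *v J y) $ i = helmholtz_green \<kappa> x y * J y $ i
        + k * (\<Sum>j\<in>UNIV. partial i (partial j (\<lambda>z. helmholtz_green \<kappa> z y)) x * J y $ j)" for y i
    proof -
      have "(maxwell_green \<kappa> x y *v J y) $ i = (\<Sum>j\<in>UNIV. (if j = i then helmholtz_green \<kappa> x y * J y $ j else 0)
          + k * (partial i (partial j (\<lambda>z. helmholtz_green \<kappa> z y)) x * J y $ j))"
        by (auto simp: maxwell_green_def matrix_vector_mult_def mat_def k_def algebra_simps intro!: sum.cong)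
      then show ?thesis by (simp add: sum.distrib sum_distrib_left)
    qed
    have meas: "(\<lambda>y. (maxwell_green \<kappa> x y *v J y) $ i) \<in> borel_measurable M" for i
    proof -
      have c: "continuous_on (ball 0 R) (\<lambda>y. green_deriv \<kappa> n ((norm (x - y))\<^sup>2))" for n
        using ne by (intro green_deriv_continuous_on continuous_intros) auto
      have "(\<lambda>y. helmholtz_green \<kappa> x y) \<in> borel_measurable M"
        unfolding M_def helmholtz_green_profile
        by (intro continuous_imp_measurable_on_sets_lebesgue c) simp
      moreover have "(\<lambda>y. partial i (partial j (\<lambda>z. helmholtz_green \<kappa> z y)) x) \<in> borel_measurable M" for j
        unfolding M_def
        by (intro continuous_imp_measurable_on_sets_lebesgue, subst continuous_on_cong[OF refl hess])
          (auto intro!: continuous_intros c)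
      ultimately show ?thesis
        unfolding comp using int_J borel_measurable_integrable[OF int_J]
        by (intro borel_measurable_add borel_measurable_times borel_measurable_sum borel_measurable_const) auto
    qed
    \<comment> \<open>Where \<open>J\<close> does not vanish the cut-off is locally \<open>1\<close>, so \<open>\<phi>\<close> has the Hessian of the
      Green's function.\<close>
    have AE: "AE y in M. G i y = (maxwell_green \<kappa> x y *v J y) $ i" for i
      using AE_J
    proof eventually_elim
      case (elim y)
      then show ?case
      proof
        assume "norm y < a"
        then show ?thesis unfolding comp G_def hess'[OF \<open>norm y < a\<close>] by (simp add: \<phi>_def \<eta>(2))
      qed (simp add: G_def comp)
    qed
    have int_sum: "integrable M (\<lambda>y. \<Sum>j\<in>UNIV. partial j (partial i \<phi>) y * J y $ j)" for i
      by (intro Bochner_Integration.integrable_sum int_smooth smooth_partial smooth int_J)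
    have int_G: "integrable M (G i)" for i
      unfolding G_def using int_sum[of i] int_smooth[OF smooth int_J[of i]]
      by (intro Bochner_Integration.integrable_add integrable_mult_right)
    have "integrable M (\<lambda>y. (maxwell_green \<kappa> x y *v J y) $ i)" for i
      by (rule integrable_cong_AE_imp[OF int_G meas AE])
    then have "electric_field \<kappa> R J x $ i = (\<integral>y. (maxwell_green \<kappa> x y *v J y) $ i \<partial>M)"
      unfolding electric_field_def M_def[symmetric] by (rule integral_component)
    also have "\<dots> = (\<integral>y. G i y \<partial>M)"
      by (rule sym, rule integral_cong_AE[OF borel_measurable_integrable[OF int_G] meas AE])
    also have "\<dots> = (\<integral>y. \<phi> y * J y $ i \<partial>M) + k * (\<integral>y. (\<Sum>j\<in>UNIV. partial j (partial i \<phi>) y * J y $ j) \<partial>M)"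
      unfolding G_def using int_sum[of i] int_smooth[OF smooth int_J[of i]] by simp
    also have "(\<integral>y. (\<Sum>j\<in>UNIV. partial j (partial i \<phi>) y * J y $ j) \<partial>M)
        = (\<Sum>j\<in>UNIV. \<integral>y. partial j (partial i \<phi>) y * J y $ j \<partial>M)"
      by (intro Bochner_Integration.integral_sum int_smooth smooth_partial smooth int_J)
    also have "\<dots> = dist_partial i (dist_div (ball 0 R) J) \<phi>"
      by (simp add: dist_partial_def dist_div_def dist_of_def sum_negf M_def mult.commute)
    also have "\<dots> = (\<integral>y. \<phi> y * W y $ i \<partial>M)"
      unfolding W(2)[OF \<phi>] by (simp add: dist_of_def M_def mult.commute)
    also have "(\<integral>y. \<phi> y * J y $ i \<partial>M) + k * (\<integral>y. \<phi> y * W y $ i \<partial>M)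
        = (\<integral>y. \<phi> y * J y $ i + k * (\<phi> y * W y $ i) \<partial>M)"
      using int_smooth[OF smooth int_J[of i]] int_smooth[OF smooth int_W[of i]] by simp
    also have "\<dots> = (\<integral>y. helmholtz_green \<kappa> x y * f i y \<partial>M)"
      by (intro Bochner_Integration.integral_cong) (auto simp: \<phi>_def f_def algebra_simps)
    finally show ?thesis .
  qed
  show thesis
  proof (rule that[OF r(1,3)])
    show "integrable (lebesgue_on (cball 0 r)) (f i)" for i
      using int_f unfolding M_def by (intro integral_ball_cball(2)[OF r(3)] f_zero) auto
    show "electric_field \<kappa> R J x $ i = (LINT y|lebesgue_on (cball 0 r). helmholtz_green \<kappa> x y * f i y)"
      if "R \<le> norm x" for x i
      unfolding field[OF that] M_def by (intro integral_ball_cball(1)[OF r(3)]) (simp add: f_zero)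
  qed
qed

section \<open>Nonradiating sources and the far field\<close>

text \<open>The components of the far-field pattern are those of the potentials. The second conclusion
  is Rellich's lemma, applied to every component.\<close>

lemma electric_field_far_field:
  fixes J :: "real^3 \<Rightarrow> complex^3"
  assumes "0 < \<kappa>" "0 < R" "J \<in> H_div_grad (ball 0 R)"
    and "compact (ess_support J)" "ess_support J \<subseteq> ball 0 R"
  obtains F where "is_far_field \<kappa> (electric_field \<kappa> R J) F"
    and "(\<And>\<theta>. norm \<theta> = 1 \<Longrightarrow> F \<theta> = 0) \<Longrightarrow> nonradiating \<kappa> R J"
proof -
  define E where "E = electric_field \<kappa> R J"
  obtain r f where r: "0 < r" "r < R" and f: "\<And>i. integrable (lebesgue_on (cball 0 r)) (f i)"
    and E: "\<And>x i. R \<le> norm x \<Longrightarrow> E x $ i = (LINT y|lebesgue_on (cball 0 r). helmholtz_green \<kappa> x y * f i y)"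
    using electric_field_potential[OF assms(2-5), where \<kappa> = \<kappa>] unfolding E_def by blast
  have "\<exists>F C. (\<forall>x. R \<le> norm x \<longrightarrow> norm (of_real (norm x) * exp (- \<i> * of_real (\<kappa> * norm x)) * E x $ i
        - F (x /\<^sub>R norm x)) \<le> C / norm x)
      \<and> ((\<forall>\<theta>. norm \<theta> = 1 \<longrightarrow> F \<theta> = 0) \<longrightarrow> (\<forall>x. R \<le> norm x \<longrightarrow> E x $ i = 0))" for i
  proof -
    obtain F C where
      "\<And>x. R \<le> norm x \<Longrightarrow> norm (of_real (norm x) * exp (- \<i> * of_real (\<kappa> * norm x))
        * (LINT y|lebesgue_on (cball 0 r). helmholtz_green \<kappa> x y * f i y) - F (x /\<^sub>R norm x)) \<le> C / norm x"
      and "\<And>x. (\<And>\<theta>. norm \<theta> = 1 \<Longrightarrow> F \<theta> = 0) \<Longrightarrow> R \<le> norm x \<Longrightarrow>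
        (LINT y|lebesgue_on (cball 0 r). helmholtz_green \<kappa> x y * f i y) = 0"
      using potential_far_field[OF r assms(1) f[of i]] by blast
    then show ?thesis by (intro exI[of _ F] exI[of _ C]) (simp add: E)
  qed
  then obtain F C where F: "\<And>i x. R \<le> norm x \<Longrightarrow> norm (of_real (norm x) * exp (- \<i> * of_real (\<kappa> * norm x)) * E x $ i
        - F i (x /\<^sub>R norm x)) \<le> C i / norm x"
      "\<And>i x. (\<forall>\<theta>. norm \<theta> = 1 \<longrightarrow> F i \<theta> = 0) \<Longrightarrow> R \<le> norm x \<Longrightarrow> E x $ i = 0"
    by metis
  define V where "V \<theta> = (\<chi> i. F i \<theta>)" for \<theta>
  define h where "h x = (of_real (norm x) * exp (- \<i> * of_real (\<kappa> * norm x))) *s E x - V (x /\<^sub>R norm x)" for x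
  have "is_far_field \<kappa> E V"
    unfolding is_far_field_def
  proof (intro exI[of _ h] conjI)
    have large: "\<forall>\<^sub>F x :: real^3 in at_infinity. R \<le> norm x"
      by (auto simp: eventually_at_infinity intro!: exI[of _ R])
    have "norm (h x) \<le> (\<Sum>i\<in>UNIV. C i) * norm (1 / norm x)" if "R \<le> norm x" for x
    proof -
      have "norm (h x) \<le> (\<Sum>i\<in>UNIV. norm (h x $ i))" 
        unfolding norm_vec_def[of "h x"] by (rule L2_set_le_sum) simp
      also have "\<dots> \<le> (\<Sum>i\<in>UNIV. C i / norm x)"
        using F(1)[OF that] by (intro sum_mono) (simp add: h_def V_def)
      finally show ?thesis by (simp add: sum_divide_distrib)
    qed
    with large have "\<forall>\<^sub>F x in at_infinity. norm (norm (h x)) \<le> (\<Sum>i\<in>UNIV. C i) * norm (1 / norm x)"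
      by (auto elim: eventually_mono)
    then show "(\<lambda>x. norm (h x)) \<in> O[at_infinity](\<lambda>x. 1 / norm x)"
      by (rule bigoI)
    show "\<forall>\<^sub>F x in at_infinity. E x = (exp (\<i> * of_real (\<kappa> * norm x)) / of_real (norm x)) *s
        (V (x /\<^sub>R norm x) + h x)"
      using large
    proof eventually_elim
      case (elim x)
      then have "norm x \<noteq> 0" using assms(2) by auto
      then show ?case by (subst vec_eq_iff) (simp add: h_def exp_minus)
    qed
  qed
  moreover have "nonradiating \<kappa> R J" if "\<And>\<theta>. norm \<theta> = 1 \<Longrightarrow> V \<theta> = 0"
    unfolding nonradiating_def E_def[symmetric]
  proof (intro allI impI)
    fix x :: "real^3" assume "x \<notin> ball 0 R"
    then have "R \<le> norm x" by simp
    then have "E x $ i = 0" for i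
      using F(2)[of i x] that by (simp add: V_def vec_eq_iff)
    then show "E x = 0" by (simp add: vec_eq_iff)
  qed
  ultimately show thesis using that unfolding E_def by blast
qed

theorem theorem3p6:
  fixes \<kappa> R :: real and J :: "real^3 \<Rightarrow> complex^3"
  assumes "\<kappa> > 0" and "R > 0"
    and "J \<in> H_div_grad (ball 0 R)"
    and "compact (ess_support J)" and "ess_support J \<subseteq> ball 0 R"
  shows "nonradiating \<kappa> R J \<longleftrightarrow>
    (\<forall>u. norm u = 1 \<longrightarrow> far_field_pattern \<kappa> (electric_field \<kappa> R J) u = 0)"
proof -
  obtain F where F: "is_far_field \<kappa> (electric_field \<kappa> R J) F"
    and Rellich: "(\<And>\<theta>. norm \<theta> = 1 \<Longrightarrow> F \<theta> = 0) \<Longrightarrow> nonradiating \<kappa> R J"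
    using electric_field_far_field[OF assms] by blast
  have pattern: "is_far_field \<kappa> (electric_field \<kappa> R J) (far_field_pattern \<kappa> (electric_field \<kappa> R J))"
    unfolding far_field_pattern_def by (rule someI[where P = "is_far_field \<kappa> (electric_field \<kappa> R J)", OF F])
  show ?thesis
  proof
    assume nr: "nonradiating \<kappa> R J"
    have "\<forall>\<^sub>F x :: real^3 in at_infinity. x \<notin> ball 0 R"
      by (auto simp: eventually_at_infinity intro!: exI[of _ R])
    then have "is_far_field \<kappa> (electric_field \<kappa> R J) (\<lambda>_. 0)"
      unfolding is_far_field_def using nr
      by (intro exI[of _ "\<lambda>_. 0"]) (auto simp: nonradiating_def elim: eventually_mono)
    then show "\<forall>u. norm u = 1 \<longrightarrow> far_field_pattern \<kappa> (electric_field \<kappa> R J) u = 0"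
      using is_far_field_unique[OF pattern] by blast
  next
    assume "\<forall>u. norm u = 1 \<longrightarrow> far_field_pattern \<kappa> (electric_field \<kappa> R J) u = 0"
    then show "nonradiating \<kappa> R J"
      using Rellich is_far_field_unique[OF F pattern] by metis
  qed
qed

end
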